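(* Let $a>-\infty$ and let $f$ be a non-constant and negative operator monotone function on $(a,\infty)$. If $A$ and $B$ are self-adjoint operators on a complex Hilbert space with spectra in $(a,\infty)$ such that $A-B\geq m>0$ for some scalar $m>0$, then $$f(A)-f(B)\geq f(\sigma_{B}+m)-f(\sigma_{B})\geq f(\sigma_{A})-f(\sigma_{A}-m)>0,$$ where $\sigma_{A}=\max\mathrm{sp}(A)$ and $\sigma_{B}=\max\mathrm{sp}(B)$.
   Context: Operators are bounded linear operators on a (nonzero) complex Hilbert space $\mathcal{H}$. $\mathrm{sp}(A)$ is the spectrum of $A$. For self-adjoint $A,B$, $A\ge B$ means $\langle (A-B)x,x\rangle\ge 0$ for all $x\in\mathcal{H}$; a scalar $m$ in an operator inequality stands for $mI$. $f(A)$ denotes the continuous functional calculus. A continuous real-valued function $f$ on an interval $J$ is operator monotone if $A\le B$ implies $f(A)\le f(B)$ for all self-adjoint operators $A,B$ (on any complex Hilbert space) with spectra in $J$. A negative function is one with $f(t)<0$ for all $t$ in its domain. *)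

theory Defs
  imports
    "HOL-Analysis.Analysis"
    "HOL-Computational_Algebra.Polynomial"
    "HOL-Algebra.Module"
    "HOL-Decision_Procs.Algebra_Aux"
begin

text \<open>
  Complex Hilbert spaces are rendered with explicit carriers, so that operator monotonicity can
  quantify over Hilbert spaces inside a formula. They are modules over the field of complex numbers
  (\<^const>\<open>cring_class_ops\<close>) with an inner product; the inherited record fields
  \<^const>\<open>mult\<close> and \<^const>\<open>one\<close> are not used.
\<close>

record 'v hilbert = "(complex, 'v) module" +
  cinner :: "'v \<Rightarrow> 'v \<Rightarrow> complex"

definition hnorm :: "('v, 'm) hilbert_scheme \<Rightarrow> 'v \<Rightarrow> real" where
  "hnorm H x = sqrt (Re (cinner H x x))"

locale complex_hilbert_space = Module.module "cring_class_ops :: complex ring" H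
  for H :: "('v, 'm) hilbert_scheme" (structure) +
  assumes nonzero: "carrier H \<noteq> {\<zero>\<^bsub>H\<^esub>}"
    and cinner_add_left: "\<lbrakk>x \<in> carrier H; y \<in> carrier H; z \<in> carrier H\<rbrakk> \<Longrightarrow>
      cinner H (x \<oplus>\<^bsub>H\<^esub> y) z = cinner H x z + cinner H y z"
    and cinner_smult_left: "\<lbrakk>x \<in> carrier H; y \<in> carrier H\<rbrakk> \<Longrightarrow>
      cinner H (c \<odot>\<^bsub>H\<^esub> x) y = c * cinner H x y"
    and cinner_commute: "\<lbrakk>x \<in> carrier H; y \<in> carrier H\<rbrakk> \<Longrightarrow>
      cinner H x y = cnj (cinner H y x)"
    and cinner_ge_zero: "x \<in> carrier H \<Longrightarrow> 0 \<le> Re (cinner H x x)"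
    and cinner_eq_zero: "\<lbrakk>x \<in> carrier H; cinner H x x = 0\<rbrakk> \<Longrightarrow> x = \<zero>\<^bsub>H\<^esub>"
    and complete: "\<lbrakk>\<And>n. s n \<in> carrier H;
        \<And>e. e > 0 \<Longrightarrow> \<exists>N. \<forall>i\<ge>N. \<forall>j\<ge>N. hnorm H (s i \<ominus>\<^bsub>H\<^esub> s j) < e\<rbrakk> \<Longrightarrow>
      \<exists>x\<in>carrier H. (\<lambda>n. hnorm H (s n \<ominus>\<^bsub>H\<^esub> x)) \<longlonglongrightarrow> 0"

text \<open>Operators are functions on the underlying type of which only the values on the carrier matter.\<close>

definition bounded_op :: "('v, 'm) hilbert_scheme \<Rightarrow> ('v \<Rightarrow> 'v) \<Rightarrow> bool" where
  "bounded_op H T \<longleftrightarrow>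
     T \<in> carrier H \<rightarrow> carrier H \<and>
     (\<forall>x\<in>carrier H. \<forall>y\<in>carrier H. T (x \<oplus>\<^bsub>H\<^esub> y) = T x \<oplus>\<^bsub>H\<^esub> T y) \<and>
     (\<forall>c. \<forall>x\<in>carrier H. T (c \<odot>\<^bsub>H\<^esub> x) = c \<odot>\<^bsub>H\<^esub> T x) \<and>
     (\<exists>K. \<forall>x\<in>carrier H. hnorm H (T x) \<le> K * hnorm H x)"

definition self_adjoint_op :: "('v, 'm) hilbert_scheme \<Rightarrow> ('v \<Rightarrow> 'v) \<Rightarrow> bool" where
  "self_adjoint_op H T \<longleftrightarrow>
     bounded_op H T \<and> (\<forall>x\<in>carrier H. \<forall>y\<in>carrier H. cinner H (T x) y = cinner H x (T y))"

definition scalar_op :: "('v, 'm) hilbert_scheme \<Rightarrow> complex \<Rightarrow> 'v \<Rightarrow> 'v" where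
  "scalar_op H c = (\<lambda>x. c \<odot>\<^bsub>H\<^esub> x)"

definition diff_op :: "('v, 'm) hilbert_scheme \<Rightarrow> ('v \<Rightarrow> 'v) \<Rightarrow> ('v \<Rightarrow> 'v) \<Rightarrow> 'v \<Rightarrow> 'v" where
  "diff_op H S T = (\<lambda>x. S x \<ominus>\<^bsub>H\<^esub> T x)"

definition op_le :: "('v, 'm) hilbert_scheme \<Rightarrow> ('v \<Rightarrow> 'v) \<Rightarrow> ('v \<Rightarrow> 'v) \<Rightarrow> bool" where
  "op_le H S T \<longleftrightarrow> (\<forall>x\<in>carrier H. cinner H (diff_op H T S x) x \<in> \<real>\<^sub>\<ge>\<^sub>0)"

definition op_norm :: "('v, 'm) hilbert_scheme \<Rightarrow> ('v \<Rightarrow> 'v) \<Rightarrow> real" where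
  "op_norm H T = (SUP x\<in>{x \<in> carrier H. hnorm H x \<le> 1}. hnorm H (T x))"

definition spectrum_op :: "('v, 'm) hilbert_scheme \<Rightarrow> ('v \<Rightarrow> 'v) \<Rightarrow> complex set" where
  "spectrum_op H T = {z. \<not> (\<exists>R. bounded_op H R \<and>
     (\<forall>x\<in>carrier H. R (diff_op H T (scalar_op H z) x) = x \<and>
                     diff_op H T (scalar_op H z) (R x) = x))}"

text \<open>For self-adjoint operators, whose spectrum is real, nonempty and compact.\<close>

definition max_spectrum :: "('v, 'm) hilbert_scheme \<Rightarrow> ('v \<Rightarrow> 'v) \<Rightarrow> real" where
  "max_spectrum H T = (GREATEST t. complex_of_real t \<in> spectrum_op H T)"

definition poly_op :: "('v, 'm) hilbert_scheme \<Rightarrow> real poly \<Rightarrow> ('v \<Rightarrow> 'v) \<Rightarrow> 'v \<Rightarrow> 'v" where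
  "poly_op H p T = (\<lambda>x. finsum H (\<lambda>i. complex_of_real (coeff p i) \<odot>\<^bsub>H\<^esub> (T ^^ i) x) {..degree p})"

text \<open>
  Continuous functional calculus of a self-adjoint operator \<open>A\<close> for a real function \<open>f\<close> continuous
  on the spectrum: \<open>f(A)\<close> is the operator-norm limit of \<open>p\<^sub>n(A)\<close> for any real polynomials
  \<open>p\<^sub>n\<close> converging to \<open>f\<close> uniformly on the spectrum. Such polynomials exist by the Weierstrass
  theorem, which makes the limit unique; extensionality fixes the irrelevant values off the carrier.
\<close>

definition fun_calc :: "('v, 'm) hilbert_scheme \<Rightarrow> (real \<Rightarrow> real) \<Rightarrow> ('v \<Rightarrow> 'v) \<Rightarrow> 'v \<Rightarrow> 'v" where
  "fun_calc H f A = (THE T. bounded_op H T \<and> T \<in> extensional (carrier H) \<and>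
     (\<forall>p :: nat \<Rightarrow> real poly.
        uniform_limit {t. complex_of_real t \<in> spectrum_op H A} (\<lambda>n. poly (p n)) f sequentially
        \<longrightarrow> (\<lambda>n. op_norm H (diff_op H (poly_op H (p n) A) T)) \<longlonglongrightarrow> 0))"

text \<open>
  The Hilbert spaces range over all those whose carrier is a set of elements of the type \<open>'v\<close>
  (HOL cannot quantify over all types in a formula). This loses nothing once \<open>'v\<close> carries at
  least one nonzero Hilbert space: then \<open>'v\<close> has at least the cardinality of the continuum, so every
  separable Hilbert space has a copy with carrier in \<open>'v\<close>; and monotonicity on separable spaces
  gives it on all spaces, since \<open>A\<close>, \<open>B\<close> and a vector \<open>x\<close> generate a separable subspace
  reducing \<open>A\<close> and \<open>B\<close>.
\<close>

definition operator_monotone_on :: "'v itself \<Rightarrow> real set \<Rightarrow> (real \<Rightarrow> real) \<Rightarrow> bool" where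
  "operator_monotone_on TYPE('v) J f \<longleftrightarrow>
     continuous_on J f \<and>
     (\<forall>(H :: 'v hilbert) A B.
        complex_hilbert_space H \<longrightarrow> self_adjoint_op H A \<longrightarrow> self_adjoint_op H B \<longrightarrow>
        spectrum_op H A \<subseteq> complex_of_real ` J \<longrightarrow> spectrum_op H B \<subseteq> complex_of_real ` J \<longrightarrow>
        op_le H A B \<longrightarrow> op_le H (fun_calc H f A) (fun_calc H f B))"

end

theory Submission
  imports Defs "HOL-Computational_Algebra.Fundamental_Theorem_Algebra"
begin

text \<open>
  The hypothesis \<open>A \<ge> B + m\<close> and operator monotonicity give \<open>f(A) \<ge> f(B + m)\<close>, and
  \<open>f(B + m) - f(B)\<close> is \<open>g(B)\<close> for the scalar function \<open>g(t) = f(t + m) - f(t)\<close>. If \<open>f\<close> is concave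
  on \<open>(a, \<infinity>)\<close>, then \<open>g\<close> is antitone, so \<open>g \<ge> g(\<sigma>\<^sub>B)\<close> on the spectrum of \<open>B\<close> and hence
  \<open>g(B) \<ge> g(\<sigma>\<^sub>B)\<close>, which is the operator inequality. Moreover \<open>\<sigma>\<^sub>B \<le> \<sigma>\<^sub>A - m\<close>, and so
  \<open>g(\<sigma>\<^sub>B) \<ge> g(\<sigma>\<^sub>A - m)\<close>. It remains to see that \<open>f\<close> is concave and strictly increasing.

  Both come from one comparison of symmetric two by two matrices
  (\<open>operator_monotone_two_by_two\<close>). Let \<open>T\<close> have eigenvalues \<open>x\<close> and \<open>y\<close> on the orthonormal vectors
  \<open>(p, q)\<close> and \<open>(q, -p)\<close>. Its upper left entry is \<open>p\<^sup>2 x + q\<^sup>2 y\<close>; for every \<open>s\<close> above this entry, \<open>T\<close> is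
  below the diagonal matrix with entries \<open>s\<close> and \<open>t\<close> as soon as \<open>t\<close> is large, and on a half-line \<open>t\<close>
  may be taken as large as desired. Operator monotonicity, tested on \<open>(1, 0)\<close>, gives
  \<open>p\<^sup>2 f(x) + q\<^sup>2 f(y) \<le> f(s)\<close>, which is concavity when \<open>s\<close> decreases to the entry. Tested on the eigenvector
  \<open>(q, -p)\<close>, it gives \<open>f(y) \<le> q\<^sup>2 f(s) + p\<^sup>2 f(t)\<close>, which shows that \<open>f\<close> cannot become constant without having
  always been constant; with concavity, this makes a non-constant \<open>f\<close> strictly increasing. A copy of the
  Hilbert space of pairs of complex numbers exists inside the type of vectors of any nonzero Hilbert space,
  since that type contains a line and a line has as many points as a plane.

  The spectral theory behind \<open>f(A)\<close> rests on \<open>poly_op_form_attained_on_spectrum\<close>: the infimum \<open>\<mu>\<close> of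
  the quadratic form of \<open>p(A)\<close> over unit vectors is \<open>p(t)\<close> for some \<open>t\<close> in the spectrum of \<open>A\<close>. Indeed
  \<open>p(A) - \<mu>\<close> is not bounded below, so neither is one of the linear factors into which \<open>p - \<mu>\<close> splits. As a
  consequence, lower bounds of \<open>p\<close> on the spectrum pass to \<open>p(A)\<close>, the norm of \<open>p(A)\<close> is at most the
  supremum of \<open>|p|\<close> on the spectrum (whence the functional calculus), and the ends of the numerical range of
  \<open>A\<close> belong to the spectrum.
\<close>

section \<open>Geometry of a Hilbert space with explicit carrier\<close>

context complex_hilbert_space
begin

lemma smult_in [simp, intro]: "x \<in> carrier H \<Longrightarrow> c \<odot>\<^bsub>H\<^esub> x \<in> carrier H"
  by (simp add: carrier_class)

lemma cinner_add_right:
  assumes "x \<in> carrier H" "y \<in> carrier H" "z \<in> carrier H"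
  shows "cinner H z (x \<oplus>\<^bsub>H\<^esub> y) = cinner H z x + cinner H z y"
  using assms cinner_commute[of z "x \<oplus>\<^bsub>H\<^esub> y"] cinner_commute[of z x] cinner_commute[of z y]
  by (simp add: cinner_add_left)

lemma cinner_smult_right:
  assumes "x \<in> carrier H" "y \<in> carrier H"
  shows "cinner H y (c \<odot>\<^bsub>H\<^esub> x) = cnj c * cinner H y x"
  using assms cinner_commute[of y "c \<odot>\<^bsub>H\<^esub> x"] cinner_commute[of y x]
  by (simp add: cinner_smult_left)

lemma cinner_zero_left [simp]: "x \<in> carrier H \<Longrightarrow> cinner H \<zero>\<^bsub>H\<^esub> x = 0"
  using cinner_add_left[of "\<zero>\<^bsub>H\<^esub>" "\<zero>\<^bsub>H\<^esub>" x] by simp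

lemma cinner_zero_right [simp]: "x \<in> carrier H \<Longrightarrow> cinner H x \<zero>\<^bsub>H\<^esub> = 0"
  using cinner_add_right[of "\<zero>\<^bsub>H\<^esub>" "\<zero>\<^bsub>H\<^esub>" x] by simp

lemma cinner_diff_left:
  assumes "x \<in> carrier H" "y \<in> carrier H" "z \<in> carrier H"
  shows "cinner H (x \<ominus>\<^bsub>H\<^esub> y) z = cinner H x z - cinner H y z"
proof -
  have "(x \<ominus>\<^bsub>H\<^esub> y) \<oplus>\<^bsub>H\<^esub> y = x"
    using assms by (simp add: M.minus_eq M.a_assoc M.l_neg)
  then show ?thesis
    using cinner_add_left[of "x \<ominus>\<^bsub>H\<^esub> y" y z] assms by simp
qed

lemma cinner_diff_right:
  assumes "x \<in> carrier H" "y \<in> carrier H" "z \<in> carrier H"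
  shows "cinner H z (x \<ominus>\<^bsub>H\<^esub> y) = cinner H z x - cinner H z y"
  using assms cinner_commute[of z "x \<ominus>\<^bsub>H\<^esub> y"] cinner_commute[of z x] cinner_commute[of z y]
  by (simp add: cinner_diff_left)

lemmas cinner_simps =
  cinner_add_left cinner_add_right cinner_smult_left cinner_smult_right
  cinner_diff_left cinner_diff_right

text \<open>
  Testing against all vectors turns an identity between vectors into one between complex numbers,
  which is how linear algebra over the explicit carrier is automated below.
\<close>

lemma vec_eqI:
  assumes "x \<in> carrier H" "y \<in> carrier H"
    and "\<And>z. z \<in> carrier H \<Longrightarrow> cinner H x z = cinner H y z"
  shows "x = y"
proof -
  have "x \<ominus>\<^bsub>H\<^esub> y = \<zero>\<^bsub>H\<^esub>"
    using assms by (intro cinner_eq_zero) (auto simp: cinner_diff_left)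
  moreover have "(x \<ominus>\<^bsub>H\<^esub> y) \<oplus>\<^bsub>H\<^esub> y = x"
    using assms by (simp add: M.minus_eq M.a_assoc M.l_neg)
  ultimately show ?thesis
    using assms by simp
qed

lemma cinner_self_real: "x \<in> carrier H \<Longrightarrow> Im (cinner H x x) = 0"
  using cinner_commute[of x x] by (metis complex_cnj_cancel_iff cnj.simps(2) neg_equal_zero)

lemma hnorm_ge_0 [simp]: "x \<in> carrier H \<Longrightarrow> 0 \<le> hnorm H x"
  by (simp add: hnorm_def cinner_ge_zero)

lemma hnorm_sq: "x \<in> carrier H \<Longrightarrow> (hnorm H x)\<^sup>2 = Re (cinner H x x)"
  by (simp add: hnorm_def cinner_ge_zero)

lemma cinner_self: "x \<in> carrier H \<Longrightarrow> cinner H x x = complex_of_real ((hnorm H x)\<^sup>2)"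
  by (simp add: hnorm_sq complex_eq_iff cinner_self_real)

lemma hnorm_eq_0_iff: "x \<in> carrier H \<Longrightarrow> hnorm H x = 0 \<longleftrightarrow> x = \<zero>\<^bsub>H\<^esub>"
  using cinner_self[of x] cinner_eq_zero[of x] cinner_zero_left[of x] by fastforce

lemma hnorm_zero [simp]: "hnorm H \<zero>\<^bsub>H\<^esub> = 0"
  by (simp add: hnorm_eq_0_iff)

lemma hnorm_smult: "x \<in> carrier H \<Longrightarrow> hnorm H (c \<odot>\<^bsub>H\<^esub> x) = cmod c * hnorm H x"
proof -
  assume x: "x \<in> carrier H"
  have "(hnorm H (c \<odot>\<^bsub>H\<^esub> x))\<^sup>2 = Re ((c * cnj c) * cinner H x x)"
    using x by (simp add: hnorm_sq cinner_simps mult_ac del: times_complex.sel)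
  also have "c * cnj c = complex_of_real ((cmod c)\<^sup>2)"
    by (rule complex_norm_square[symmetric])
  also have "Re (complex_of_real ((cmod c)\<^sup>2) * cinner H x x) = (cmod c * hnorm H x)\<^sup>2"
    using x by (simp add: hnorm_sq power_mult_distrib del: of_real_power)
  finally show ?thesis
    using x by (simp add: power2_eq_iff_nonneg)
qed

lemma self_adjoint_closed: "self_adjoint_op H S \<Longrightarrow> x \<in> carrier H \<Longrightarrow> S x \<in> carrier H"
  by (auto simp: self_adjoint_op_def bounded_op_def)

lemma self_adjoint_form:
  assumes "self_adjoint_op H S" "x \<in> carrier H"
  shows "cinner H (S x) x = complex_of_real (Re (cinner H (S x) x))"
proof -
  have "cinner H (S x) x = cnj (cinner H (S x) x)"
    using assms cinner_commute[of x "S x"] self_adjoint_closed by (simp add: self_adjoint_op_def)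
  then have "Im (cinner H (S x) x) = 0"
    by (metis cnj.simps(2) neg_equal_zero)
  then show ?thesis
    by (simp add: complex_eq_iff)
qed

text \<open>
  The form is nonnegative at \<open>x + t b y\<close> for all real \<open>t\<close>, where \<open>b = \<langle>S x, y\<rangle>\<close>. Besides the norm estimates
  (\<open>S\<close> the identity), the forms of \<open>A - \<mu>\<close> for \<open>\<mu>\<close> a lower bound of \<open>A\<close> will be used.
\<close>

lemma positive_form_Cauchy_Schwarz:
  assumes S: "self_adjoint_op H S"
    and pos: "\<And>x. x \<in> carrier H \<Longrightarrow> 0 \<le> Re (cinner H (S x) x)"
    and x: "x \<in> carrier H" and y: "y \<in> carrier H"
  shows "(cmod (cinner H (S x) y))\<^sup>2 \<le> Re (cinner H (S x) x) * Re (cinner H (S y) y)"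
proof -
  let ?b = "cinner H (S x) y" and ?a = "Re (cinner H (S x) x)" and ?c = "Re (cinner H (S y) y)"
  have cl: "\<And>x. x \<in> carrier H \<Longrightarrow> S x \<in> carrier H"
    using S self_adjoint_closed by blast
  have yx: "cinner H (S y) x = cnj ?b"
    using S x y cl cinner_commute[of "S x" y] by (simp add: self_adjoint_op_def bounded_op_def)
  have quad: "0 \<le> ?a + 2 * t * (cmod ?b)\<^sup>2 + t * t * (cmod ?b)\<^sup>2 * ?c" for t :: real
  proof -
    let ?d = "complex_of_real t * ?b"
    have "S (x \<oplus>\<^bsub>H\<^esub> ?d \<odot>\<^bsub>H\<^esub> y) = S x \<oplus>\<^bsub>H\<^esub> ?d \<odot>\<^bsub>H\<^esub> S y"
      using S x y by (simp add: self_adjoint_op_def bounded_op_def)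
    then have "cinner H (S (x \<oplus>\<^bsub>H\<^esub> ?d \<odot>\<^bsub>H\<^esub> y)) (x \<oplus>\<^bsub>H\<^esub> ?d \<odot>\<^bsub>H\<^esub> y) =
        cinner H (S x) x + 2 * t * (?b * cnj ?b) + t * t * (?b * cnj ?b) * cinner H (S y) y"
      using x y cl by (simp add: cinner_simps yx algebra_simps)
    also have "?b * cnj ?b = complex_of_real ((cmod ?b)\<^sup>2)"
      by (rule complex_norm_square[symmetric])
    finally have "Re (cinner H (S (x \<oplus>\<^bsub>H\<^esub> ?d \<odot>\<^bsub>H\<^esub> y)) (x \<oplus>\<^bsub>H\<^esub> ?d \<odot>\<^bsub>H\<^esub> y)) =
        ?a + 2 * t * (cmod ?b)\<^sup>2 + t * t * (cmod ?b)\<^sup>2 * ?c"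
      by simp
    then show ?thesis
      using pos[of "x \<oplus>\<^bsub>H\<^esub> ?d \<odot>\<^bsub>H\<^esub> y"] x y by simp
  qed
  show ?thesis
  proof (cases "?c = 0")
    case True
    have "cmod ?b = 0"
    proof (rule ccontr)
      assume "cmod ?b \<noteq> 0"
      then show False
        \<comment> \<open>A value of \<open>t\<close> at which the now affine expression equals \<open>-1\<close>.\<close>
        using quad[of "- (?a + 1) / (2 * (cmod ?b)\<^sup>2)"] True by (simp add: field_simps)
    qed
    then show ?thesis
      using True by simp
  next
    case False
    then have "?c > 0"
      using pos[OF y] by simp
    then show ?thesis
      using quad[of "- 1 / ?c"] by (simp add: field_simps power2_eq_square)
  qed
qed

lemma Cauchy_Schwarz:
  assumes "x \<in> carrier H" "y \<in> carrier H"
  shows "cmod (cinner H x y) \<le> hnorm H x * hnorm H y"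
proof -
  have "self_adjoint_op H (\<lambda>x. x)"
    by (auto simp: self_adjoint_op_def bounded_op_def intro!: exI[of _ 1])
  then have "(cmod (cinner H x y))\<^sup>2 \<le> (hnorm H x * hnorm H y)\<^sup>2"
    using positive_form_Cauchy_Schwarz[of "\<lambda>x. x" x y] assms
    by (simp add: cinner_ge_zero hnorm_sq power_mult_distrib)
  then show ?thesis
    using assms by (simp add: power2_le_iff_abs_le)
qed

lemma hnorm_add_le:
  assumes "x \<in> carrier H" "y \<in> carrier H"
  shows "hnorm H (x \<oplus>\<^bsub>H\<^esub> y) \<le> hnorm H x + hnorm H y"
proof -
  have "Re (cinner H x y) \<le> hnorm H x * hnorm H y"
    using Cauchy_Schwarz[OF assms] complex_Re_le_cmod order_trans by blast
  moreover have "cinner H y x = cnj (cinner H x y)"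
    using assms cinner_commute by blast
  ultimately have "(hnorm H (x \<oplus>\<^bsub>H\<^esub> y))\<^sup>2 \<le> (hnorm H x + hnorm H y)\<^sup>2"
    using assms by (simp add: power2_sum hnorm_sq cinner_simps)
  then show ?thesis
    using assms by (simp add: power2_le_iff_abs_le)
qed

lemma hnorm_minus_commute:
  assumes "x \<in> carrier H" "y \<in> carrier H"
  shows "hnorm H (x \<ominus>\<^bsub>H\<^esub> y) = hnorm H (y \<ominus>\<^bsub>H\<^esub> x)"
proof -
  have "x \<ominus>\<^bsub>H\<^esub> y = (- 1) \<odot>\<^bsub>H\<^esub> (y \<ominus>\<^bsub>H\<^esub> x)"
    using assms by (intro vec_eqI) (auto simp: cinner_simps)
  then show ?thesis
    using assms by (simp add: hnorm_smult)
qed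

lemma hnorm_triangle:
  assumes "x \<in> carrier H" "y \<in> carrier H" "z \<in> carrier H"
  shows "hnorm H (x \<ominus>\<^bsub>H\<^esub> z) \<le> hnorm H (x \<ominus>\<^bsub>H\<^esub> y) + hnorm H (y \<ominus>\<^bsub>H\<^esub> z)"
proof -
  have "x \<ominus>\<^bsub>H\<^esub> z = (x \<ominus>\<^bsub>H\<^esub> y) \<oplus>\<^bsub>H\<^esub> (y \<ominus>\<^bsub>H\<^esub> z)"
    using assms by (intro vec_eqI) (auto simp: cinner_simps)
  then show ?thesis
    using assms hnorm_add_le by simp
qed

lemma ex_nonzero: obtains x where "x \<in> carrier H" "hnorm H x > 0"
proof -
  obtain x where "x \<in> carrier H" "x \<noteq> \<zero>\<^bsub>H\<^esub>"
    using nonzero by auto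
  then show ?thesis
    using that[of x] hnorm_eq_0_iff[of x] hnorm_ge_0[of x] by linarith
qed

end

section \<open>Bounded operators and invertibility\<close>

text \<open>
  Inside the locale of Hilbert spaces, the unqualified name of the right-hand side denotes a fact about
  squares in an abstract ring.
\<close>

lemmas sq_eq_mult = power2_eq_square [where 'a = real]

context complex_hilbert_space
begin

lemma diff_self [simp]: "x \<in> carrier H \<Longrightarrow> x \<ominus>\<^bsub>H\<^esub> x = \<zero>\<^bsub>H\<^esub>"
  by (simp add: M.minus_eq M.r_neg)

lemma hnorm_diff_eq_0_iff:
  assumes "x \<in> carrier H" "y \<in> carrier H"
  shows "hnorm H (x \<ominus>\<^bsub>H\<^esub> y) = 0 \<longleftrightarrow> x = y"
proof
  assume "hnorm H (x \<ominus>\<^bsub>H\<^esub> y) = 0"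
  then have "x \<ominus>\<^bsub>H\<^esub> y = \<zero>\<^bsub>H\<^esub>"
    using assms by (simp add: hnorm_eq_0_iff)
  then show "x = y"
    using assms cinner_diff_left[of x y] by (intro vec_eqI) auto
qed (use assms in simp)

lemma bounded_op_closed: "bounded_op H T \<Longrightarrow> x \<in> carrier H \<Longrightarrow> T x \<in> carrier H"
  by (auto simp: bounded_op_def)

lemma bounded_op_add:
  "bounded_op H T \<Longrightarrow> x \<in> carrier H \<Longrightarrow> y \<in> carrier H \<Longrightarrow> T (x \<oplus>\<^bsub>H\<^esub> y) = T x \<oplus>\<^bsub>H\<^esub> T y"
  by (auto simp: bounded_op_def)

lemma bounded_op_smult:
  "bounded_op H T \<Longrightarrow> x \<in> carrier H \<Longrightarrow> T (c \<odot>\<^bsub>H\<^esub> x) = c \<odot>\<^bsub>H\<^esub> T x"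
  by (auto simp: bounded_op_def)

lemma bounded_op_diff:
  assumes T: "bounded_op H T" and "x \<in> carrier H" "y \<in> carrier H"
  shows "T (x \<ominus>\<^bsub>H\<^esub> y) = T x \<ominus>\<^bsub>H\<^esub> T y"
proof -
  have *: "u \<ominus>\<^bsub>H\<^esub> v = u \<oplus>\<^bsub>H\<^esub> (- 1) \<odot>\<^bsub>H\<^esub> v" if "u \<in> carrier H" "v \<in> carrier H" for u v
    using that by (intro vec_eqI) (auto simp: cinner_simps)
  show ?thesis
    using assms by (simp add: * bounded_op_add bounded_op_smult bounded_op_closed)
qed

lemma bounded_op_bound:
  assumes T: "bounded_op H T"
  obtains K where "K > 0" "\<And>x. x \<in> carrier H \<Longrightarrow> hnorm H (T x) \<le> K * hnorm H x"
proof -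
  obtain K where K: "\<And>x. x \<in> carrier H \<Longrightarrow> hnorm H (T x) \<le> K * hnorm H x"
    using T unfolding bounded_op_def by blast
  show ?thesis
  proof (rule that[of "max K 1"])
    fix x assume x: "x \<in> carrier H"
    have "K * hnorm H x \<le> max K 1 * hnorm H x"
      using x by (intro mult_right_mono) auto
    then show "hnorm H (T x) \<le> max K 1 * hnorm H x"
      using K[OF x] by linarith
  qed simp
qed

lemma hnorm_diff_le:
  assumes "x \<in> carrier H" "y \<in> carrier H"
  shows "hnorm H (x \<ominus>\<^bsub>H\<^esub> y) \<le> hnorm H x + hnorm H y"
proof -
  have "x \<ominus>\<^bsub>H\<^esub> y = x \<oplus>\<^bsub>H\<^esub> (- 1) \<odot>\<^bsub>H\<^esub> y"
    using assms by (intro vec_eqI) (auto simp: cinner_simps)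
  then show ?thesis
    using assms hnorm_add_le[of x "(- 1) \<odot>\<^bsub>H\<^esub> y"] by (simp add: hnorm_smult)
qed

lemma bounded_op_lincomb:
  assumes S: "bounded_op H S" and T: "bounded_op H T"
  shows "bounded_op H (\<lambda>x. S x \<oplus>\<^bsub>H\<^esub> c \<odot>\<^bsub>H\<^esub> T x)"
proof -
  obtain K where K: "K > 0" "\<And>x. x \<in> carrier H \<Longrightarrow> hnorm H (S x) \<le> K * hnorm H x"
    using S by (rule bounded_op_bound) blast
  obtain L where L: "L > 0" "\<And>x. x \<in> carrier H \<Longrightarrow> hnorm H (T x) \<le> L * hnorm H x"
    using T by (rule bounded_op_bound) blast
  note cl = bounded_op_closed[OF S] bounded_op_closed[OF T]
  show ?thesis
    unfolding bounded_op_def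
  proof (intro conjI ballI allI)
    show "(\<lambda>x. S x \<oplus>\<^bsub>H\<^esub> c \<odot>\<^bsub>H\<^esub> T x) \<in> carrier H \<rightarrow> carrier H"
      using cl by auto
    show "\<exists>M. \<forall>x\<in>carrier H. hnorm H (S x \<oplus>\<^bsub>H\<^esub> c \<odot>\<^bsub>H\<^esub> T x) \<le> M * hnorm H x"
    proof (intro exI ballI)
      fix x assume x: "x \<in> carrier H"
      have "hnorm H (S x \<oplus>\<^bsub>H\<^esub> c \<odot>\<^bsub>H\<^esub> T x) \<le> hnorm H (S x) + cmod c * hnorm H (T x)"
        using hnorm_add_le[of "S x" "c \<odot>\<^bsub>H\<^esub> T x"] x cl by (simp add: hnorm_smult)
      also have "\<dots> \<le> K * hnorm H x + cmod c * (L * hnorm H x)"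
        using K L x by (intro add_mono mult_left_mono) auto
      finally show "hnorm H (S x \<oplus>\<^bsub>H\<^esub> c \<odot>\<^bsub>H\<^esub> T x) \<le> (K + cmod c * L) * hnorm H x"
        by (simp add: algebra_simps)
    qed
  next
    fix x y assume "x \<in> carrier H" "y \<in> carrier H"
    then show "S (x \<oplus>\<^bsub>H\<^esub> y) \<oplus>\<^bsub>H\<^esub> c \<odot>\<^bsub>H\<^esub> T (x \<oplus>\<^bsub>H\<^esub> y) =
        S x \<oplus>\<^bsub>H\<^esub> c \<odot>\<^bsub>H\<^esub> T x \<oplus>\<^bsub>H\<^esub> (S y \<oplus>\<^bsub>H\<^esub> c \<odot>\<^bsub>H\<^esub> T y)"
      using cl by (intro vec_eqI)
        (simp_all add: bounded_op_add[OF S] bounded_op_add[OF T] cinner_simps algebra_simps)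
  next
    fix d x assume "x \<in> carrier H"
    then show "S (d \<odot>\<^bsub>H\<^esub> x) \<oplus>\<^bsub>H\<^esub> c \<odot>\<^bsub>H\<^esub> T (d \<odot>\<^bsub>H\<^esub> x) = d \<odot>\<^bsub>H\<^esub> (S x \<oplus>\<^bsub>H\<^esub> c \<odot>\<^bsub>H\<^esub> T x)"
      using cl by (intro vec_eqI)
        (simp_all add: bounded_op_smult[OF S] bounded_op_smult[OF T] cinner_simps algebra_simps)
  qed
qed

lemma bounded_op_comp:
  assumes S: "bounded_op H S" and T: "bounded_op H T"
  shows "bounded_op H (\<lambda>x. S (T x))"
proof -
  obtain K where K: "K > 0" "\<And>x. x \<in> carrier H \<Longrightarrow> hnorm H (S x) \<le> K * hnorm H x"
    using S by (rule bounded_op_bound) blast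
  obtain L where L: "L > 0" "\<And>x. x \<in> carrier H \<Longrightarrow> hnorm H (T x) \<le> L * hnorm H x"
    using T by (rule bounded_op_bound) blast
  note cl = bounded_op_closed[OF S] bounded_op_closed[OF T]
  have "hnorm H (S (T x)) \<le> (K * L) * hnorm H x" if x: "x \<in> carrier H" for x
  proof -
    have "hnorm H (S (T x)) \<le> K * hnorm H (T x)"
      using K(2) cl x by blast
    also have "\<dots> \<le> K * (L * hnorm H x)"
      using L(2)[OF x] K(1) by (intro mult_left_mono) auto
    finally show ?thesis
      by (simp only: mult.assoc)
  qed
  then show ?thesis
    using S T cl by (auto simp: bounded_op_def Pi_iff intro!: exI[of _ "K * L"])
qed

lemma bounded_op_ident: "bounded_op H (\<lambda>x. x)"
  by (auto simp: bounded_op_def intro!: exI[of _ 1])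

lemma bounded_op_cong:
  assumes "bounded_op H S" "\<And>x. x \<in> carrier H \<Longrightarrow> T x = S x"
  shows "bounded_op H T"
  using assms by (simp add: bounded_op_def Pi_iff)

lemma bounded_op_diff_op:
  assumes "bounded_op H S" "bounded_op H T"
  shows "bounded_op H (diff_op H S T)"
  using bounded_op_lincomb[OF assms, of "- 1"]
proof (rule bounded_op_cong)
  fix x assume "x \<in> carrier H"
  then show "diff_op H S T x = S x \<oplus>\<^bsub>H\<^esub> (- 1) \<odot>\<^bsub>H\<^esub> T x"
    unfolding diff_op_def using assms
    by (intro vec_eqI) (auto simp: cinner_simps bounded_op_closed)
qed

lemma bounded_op_scalar_op: "bounded_op H (scalar_op H c)"
proof -
  have "bounded_op H (\<lambda>x. x \<oplus>\<^bsub>H\<^esub> (c - 1) \<odot>\<^bsub>H\<^esub> x)"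
    by (rule bounded_op_lincomb[OF bounded_op_ident bounded_op_ident])
  then show ?thesis
    by (rule bounded_op_cong)
      (auto simp: scalar_op_def cinner_simps algebra_simps intro!: vec_eqI)
qed

lemma self_adjoint_bounded: "self_adjoint_op H S \<Longrightarrow> bounded_op H S"
  by (simp add: self_adjoint_op_def)

lemma self_adjoint_lincomb:
  assumes "self_adjoint_op H S" "self_adjoint_op H T"
  shows "self_adjoint_op H (\<lambda>x. S x \<oplus>\<^bsub>H\<^esub> complex_of_real r \<odot>\<^bsub>H\<^esub> T x)"
  using assms
  by (auto simp: self_adjoint_op_def bounded_op_lincomb cinner_simps bounded_op_closed)

lemma self_adjoint_ident: "self_adjoint_op H (\<lambda>x. x)"
  by (simp add: self_adjoint_op_def bounded_op_ident)

text \<open>The case \<open>y = S x\<close> of the Cauchy-Schwarz inequality for the form of \<open>S\<close>.\<close>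

lemma positive_hnorm_le:
  assumes S: "self_adjoint_op H S"
    and pos: "\<And>x. x \<in> carrier H \<Longrightarrow> 0 \<le> Re (cinner H (S x) x)"
    and le: "\<And>x. x \<in> carrier H \<Longrightarrow> Re (cinner H (S x) x) \<le> r * (hnorm H x)\<^sup>2"
    and x: "x \<in> carrier H"
  shows "(hnorm H (S x))\<^sup>2 \<le> r * Re (cinner H (S x) x)"
proof (cases "hnorm H (S x) = 0")
  case True
  then have "S x = \<zero>\<^bsub>H\<^esub>"
    using hnorm_eq_0_iff self_adjoint_closed[OF S] x by blast
  then show ?thesis
    using x by simp
next
  case False
  let ?n = "(hnorm H (S x))\<^sup>2"
  have Sx: "S x \<in> carrier H"
    using S x by (rule self_adjoint_closed)
  have "?n\<^sup>2 = (cmod (cinner H (S x) (S x)))\<^sup>2"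
    using cinner_self[OF Sx] by (simp add: norm_power)
  also have "\<dots> \<le> Re (cinner H (S x) x) * Re (cinner H (S (S x)) (S x))"
    using positive_form_Cauchy_Schwarz[OF S pos x Sx] by simp
  also have "\<dots> \<le> Re (cinner H (S x) x) * (r * ?n)"
    using pos[OF x] le[OF Sx] by (intro mult_left_mono) auto
  also have "\<dots> = (r * Re (cinner H (S x) x)) * ?n"
    by (simp only: mult_ac)
  finally have "?n * ?n \<le> (r * Re (cinner H (S x) x)) * ?n"
    unfolding sq_eq_mult[of ?n] .
  moreover have "?n > 0"
    using False by simp
  ultimately show ?thesis
    using mult_le_cancel_right_pos by blast
qed

lemma geometric_convergent:
  assumes s: "\<And>n. s n \<in> carrier H"
    and step: "\<And>n. hnorm H (s (Suc n) \<ominus>\<^bsub>H\<^esub> s n) \<le> K * \<rho> ^ n"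
    and \<rho>: "0 \<le> \<rho>" "\<rho> < 1"
  shows "\<exists>x\<in>carrier H. (\<lambda>n. hnorm H (s n \<ominus>\<^bsub>H\<^esub> x)) \<longlonglongrightarrow> 0"
proof (rule complete[OF s])
  fix e :: real assume "e > 0"
  have "0 \<le> K * \<rho> ^ 0"
    using hnorm_ge_0 step by (rule order_trans) (simp add: s)
  then have K: "K \<ge> 0"
    by simp
  have tail: "hnorm H (s (i + d) \<ominus>\<^bsub>H\<^esub> s i) \<le> K / (1 - \<rho>) * (\<rho> ^ i - \<rho> ^ (i + d))" for i d
  proof (induction d)
    case 0
    then show ?case
      using s by simp
  next
    case (Suc d)
    have "hnorm H (s (i + Suc d) \<ominus>\<^bsub>H\<^esub> s i) \<le>
        K * \<rho> ^ (i + d) + K / (1 - \<rho>) * (\<rho> ^ i - \<rho> ^ (i + d))"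
      using hnorm_triangle[of "s (i + Suc d)" "s (i + d)" "s i"] s step[of "i + d"] Suc.IH
      by simp
    also have "\<dots> = K / (1 - \<rho>) * (\<rho> ^ i - \<rho> ^ (i + Suc d))"
      using \<rho> by (simp add: field_simps)
    finally show ?case .
  qed
  have "(\<lambda>n. K / (1 - \<rho>) * \<rho> ^ n) \<longlonglongrightarrow> K / (1 - \<rho>) * 0"
    using \<rho> by (intro tendsto_intros LIMSEQ_power_zero) auto
  then have "\<forall>\<^sub>F n in sequentially. K / (1 - \<rho>) * \<rho> ^ n < e"
    using \<open>e > 0\<close> by (auto dest: order_tendstoD)
  then obtain N where N: "\<And>n. n \<ge> N \<Longrightarrow> K / (1 - \<rho>) * \<rho> ^ n < e"
    by (auto simp: eventually_sequentially)
  have *: "hnorm H (s j \<ominus>\<^bsub>H\<^esub> s i) < e" if "i \<ge> N" "i \<le> j" for i j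
  proof -
    have "hnorm H (s j \<ominus>\<^bsub>H\<^esub> s i) \<le> K / (1 - \<rho>) * (\<rho> ^ i - \<rho> ^ j)"
      using tail[of i "j - i"] that by simp
    also have "\<dots> \<le> K / (1 - \<rho>) * \<rho> ^ i"
      using K \<rho> by (intro mult_left_mono) auto
    also have "\<dots> < e"
      using N that by blast
    finally show ?thesis .
  qed
  have "hnorm H (s i \<ominus>\<^bsub>H\<^esub> s j) < e" if "i \<ge> N" "j \<ge> N" for i j
    using *[of i j] *[of j i] that hnorm_minus_commute[OF s s, of i j] by (cases "i \<le> j") auto
  then show "\<exists>N. \<forall>i\<ge>N. \<forall>j\<ge>N. hnorm H (s i \<ominus>\<^bsub>H\<^esub> s j) < e"
    by blast
qed

text \<open>
  The iteration \<open>x \<mapsto> x + (y - S x) / L\<close>, with \<open>L\<close> a bound for \<open>S\<close>, solves \<open>S x = y\<close>: its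
  linear part \<open>1 - S / L\<close> lies between \<open>0\<close> and \<open>1 - \<delta> / L\<close>, so it is a contraction.
\<close>

lemma bounded_below_surj:
  assumes S: "self_adjoint_op H S" and \<delta>: "\<delta> > 0"
    and below: "\<And>x. x \<in> carrier H \<Longrightarrow> \<delta> * (hnorm H x)\<^sup>2 \<le> Re (cinner H (S x) x)"
    and y: "y \<in> carrier H"
  shows "\<exists>x\<in>carrier H. S x = y"
proof -
  note cl [simp] = self_adjoint_closed[OF S]
  note bS = self_adjoint_bounded[OF S]
  obtain L0 where L0: "L0 > 0" "\<And>x. x \<in> carrier H \<Longrightarrow> hnorm H (S x) \<le> L0 * hnorm H x"
    using bS by (rule bounded_op_bound) blast
  define L where "L = max L0 \<delta>"
  have L: "L > 0" "\<delta> \<le> L"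
    using L0 by (auto simp: L_def)
  define \<rho> where "\<rho> = 1 - \<delta> / L"
  have \<rho>: "0 \<le> \<rho>" "\<rho> < 1"
    using L \<delta> by (auto simp: \<rho>_def)
  define D where "D x = x \<oplus>\<^bsub>H\<^esub> complex_of_real (- 1 / L) \<odot>\<^bsub>H\<^esub> S x" for x
  have D: "self_adjoint_op H D"
    unfolding D_def[abs_def] using self_adjoint_ident S by (rule self_adjoint_lincomb)
  have formD: "Re (cinner H (D x) x) = (hnorm H x)\<^sup>2 - Re (cinner H (S x) x) / L"
    if "x \<in> carrier H" for x
    using that by (simp add: D_def cinner_simps hnorm_sq)
  have formS: "Re (cinner H (S x) x) \<le> L * (hnorm H x)\<^sup>2" if x: "x \<in> carrier H" for x
  proof -
    have "Re (cinner H (S x) x) \<le> hnorm H (S x) * hnorm H x"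
      using Cauchy_Schwarz[of "S x" x] complex_Re_le_cmod[of "cinner H (S x) x"] x by simp
    also have "\<dots> \<le> (L0 * hnorm H x) * hnorm H x"
      using L0 x by (intro mult_right_mono) auto
    also have "\<dots> = L0 * (hnorm H x)\<^sup>2"
      by (simp add: sq_eq_mult)
    also have "\<dots> \<le> L * (hnorm H x)\<^sup>2"
      by (intro mult_right_mono) (auto simp: L_def)
    finally show ?thesis .
  qed
  have posD: "0 \<le> Re (cinner H (D x) x)" if "x \<in> carrier H" for x
  proof -
    have "Re (cinner H (S x) x) / L \<le> (hnorm H x)\<^sup>2"
      using formS[OF that] L by (simp add: divide_le_eq mult.commute)
    then show ?thesis
      using formD[OF that] by simp
  qed
  have leD: "Re (cinner H (D x) x) \<le> \<rho> * (hnorm H x)\<^sup>2" if "x \<in> carrier H" for x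
    using formD[OF that] below[OF that] L by (simp add: \<rho>_def field_simps)
  have contr: "hnorm H (D x) \<le> \<rho> * hnorm H x" if x: "x \<in> carrier H" for x
  proof -
    have "(hnorm H (D x))\<^sup>2 \<le> \<rho> * Re (cinner H (D x) x)"
      using D posD leD x by (rule positive_hnorm_le)
    also have "\<dots> \<le> \<rho> * (\<rho> * (hnorm H x)\<^sup>2)"
      using leD[OF x] \<rho> by (intro mult_left_mono) auto
    finally have "(hnorm H (D x))\<^sup>2 \<le> (\<rho> * hnorm H x)\<^sup>2"
      by (simp add: sq_eq_mult mult_ac)
    then show ?thesis
      using \<rho> x self_adjoint_closed[OF D x] by (simp add: power2_le_iff_abs_le)
  qed
  define G where "G x = x \<oplus>\<^bsub>H\<^esub> complex_of_real (1 / L) \<odot>\<^bsub>H\<^esub> (y \<ominus>\<^bsub>H\<^esub> S x)" for x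
  define s where "s n = (G ^^ n) \<zero>\<^bsub>H\<^esub>" for n
  have s_closed [simp]: "s n \<in> carrier H" for n
    by (induction n) (auto simp: s_def G_def y)
  have s_Suc: "s (Suc n) = G (s n)" for n
    by (simp add: s_def)
  have GD: "G u \<ominus>\<^bsub>H\<^esub> G v = D (u \<ominus>\<^bsub>H\<^esub> v)" if "u \<in> carrier H" "v \<in> carrier H" for u v
    using that y unfolding G_def D_def
    by (intro vec_eqI) (auto simp: cinner_simps bounded_op_diff[OF bS] algebra_simps)
  have step: "hnorm H (s (Suc n) \<ominus>\<^bsub>H\<^esub> s n) \<le> hnorm H (s 1 \<ominus>\<^bsub>H\<^esub> s 0) * \<rho> ^ n" for n
  proof (induction n)
    case (Suc n)
    have "hnorm H (s (Suc (Suc n)) \<ominus>\<^bsub>H\<^esub> s (Suc n)) \<le> \<rho> * hnorm H (s (Suc n) \<ominus>\<^bsub>H\<^esub> s n)"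
      using contr[of "s (Suc n) \<ominus>\<^bsub>H\<^esub> s n"]
        GD[of "s (Suc n)" "s n"] s_closed M.minus_closed
      by (metis s_Suc)
    also have "\<dots> \<le> \<rho> * (hnorm H (s 1 \<ominus>\<^bsub>H\<^esub> s 0) * \<rho> ^ n)"
      using Suc.IH \<rho> by (intro mult_left_mono)
    finally show ?case
      by (simp add: mult_ac)
  qed simp
  obtain x where x: "x \<in> carrier H" and lim: "(\<lambda>n. hnorm H (s n \<ominus>\<^bsub>H\<^esub> x)) \<longlonglongrightarrow> 0"
    using geometric_convergent[of s, OF _ step \<rho>] by auto
  have "hnorm H (S x \<ominus>\<^bsub>H\<^esub> y) \<le> L0 * hnorm H (s n \<ominus>\<^bsub>H\<^esub> x) + L * (hnorm H (s 1 \<ominus>\<^bsub>H\<^esub> s 0) * \<rho> ^ n)" for n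
  proof -
    have "y \<ominus>\<^bsub>H\<^esub> S (s n) = complex_of_real L \<odot>\<^bsub>H\<^esub> (s (Suc n) \<ominus>\<^bsub>H\<^esub> s n)"
      using L y by (intro vec_eqI) (auto simp: cinner_simps s_Suc G_def)
    then have "hnorm H (y \<ominus>\<^bsub>H\<^esub> S (s n)) \<le> L * (hnorm H (s 1 \<ominus>\<^bsub>H\<^esub> s 0) * \<rho> ^ n)"
      using L step[of n] by (simp add: hnorm_smult)
    moreover have "hnorm H (S (s n) \<ominus>\<^bsub>H\<^esub> S x) \<le> L0 * hnorm H (s n \<ominus>\<^bsub>H\<^esub> x)"
      using L0(2)[of "s n \<ominus>\<^bsub>H\<^esub> x"] x by (simp add: bounded_op_diff[OF bS])
    ultimately show ?thesis
      using hnorm_triangle[of "S x" "S (s n)" y] x y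
        hnorm_minus_commute[of "S x" "S (s n)"] hnorm_minus_commute[of "S (s n)" y] by simp
  qed
  moreover have "(\<lambda>n. L0 * hnorm H (s n \<ominus>\<^bsub>H\<^esub> x) + L * (hnorm H (s 1 \<ominus>\<^bsub>H\<^esub> s 0) * \<rho> ^ n))
      \<longlonglongrightarrow> L0 * 0 + L * (hnorm H (s 1 \<ominus>\<^bsub>H\<^esub> s 0) * 0)"
    using \<rho> lim by (intro tendsto_intros LIMSEQ_power_zero) auto
  ultimately have "hnorm H (S x \<ominus>\<^bsub>H\<^esub> y) \<le> 0"
    using LIMSEQ_le_const by fastforce
  then have "hnorm H (S x \<ominus>\<^bsub>H\<^esub> y) = 0"
    using x y by (intro antisym) auto
  then have "S x = y"
    using x y by (simp add: hnorm_diff_eq_0_iff)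
  then show ?thesis
    using x by blast
qed

lemma bounded_below_invertible:
  assumes S: "self_adjoint_op H S" and \<delta>: "\<delta> > 0"
    and below: "\<And>x. x \<in> carrier H \<Longrightarrow> \<delta> * (hnorm H x)\<^sup>2 \<le> Re (cinner H (S x) x)"
  shows "\<exists>R. bounded_op H R \<and> (\<forall>x\<in>carrier H. R (S x) = x \<and> S (R x) = x)"
proof -
  note cl [simp] = self_adjoint_closed[OF S]
  note bS = self_adjoint_bounded[OF S]
  define R where "R y = (SOME x. x \<in> carrier H \<and> S x = y)" for y
  have R: "R y \<in> carrier H \<and> S (R y) = y" if "y \<in> carrier H" for y
  proof -
    have "\<exists>x. x \<in> carrier H \<and> S x = y"
      using bounded_below_surj[OF S \<delta> below that] by blast
    then show ?thesis
      unfolding R_def by (rule someI_ex)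
  qed
  have norm: "hnorm H x \<le> 1 / \<delta> * hnorm H (S x)" if x: "x \<in> carrier H" for x
  proof (cases "hnorm H x = 0")
    case False
    have "\<delta> * (hnorm H x)\<^sup>2 \<le> hnorm H (S x) * hnorm H x"
      using below[OF x] Cauchy_Schwarz[of "S x" x] complex_Re_le_cmod[of "cinner H (S x) x"] x
      by simp
    then have "(\<delta> * hnorm H x) * hnorm H x \<le> hnorm H (S x) * hnorm H x"
      by (simp add: sq_eq_mult mult.assoc)
    then have "\<delta> * hnorm H x \<le> hnorm H (S x)"
      by (rule mult_right_le_imp_le) (use False hnorm_ge_0[OF x] in linarith)
    then show ?thesis
      using \<delta> by (simp add: field_simps)
  qed (use \<delta> x in simp)
  have inj: "u = v" if "u \<in> carrier H" "v \<in> carrier H" "S u = S v" for u v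
  proof -
    have "S (u \<ominus>\<^bsub>H\<^esub> v) = \<zero>\<^bsub>H\<^esub>"
      using that by (simp add: bounded_op_diff[OF bS])
    then have "hnorm H (u \<ominus>\<^bsub>H\<^esub> v) = 0"
      using norm[of "u \<ominus>\<^bsub>H\<^esub> v"] that by (intro antisym) simp_all
    then show ?thesis
      using that by (simp add: hnorm_diff_eq_0_iff)
  qed
  have "bounded_op H R"
    unfolding bounded_op_def
  proof (intro conjI ballI allI)
    show "\<exists>K. \<forall>x\<in>carrier H. hnorm H (R x) \<le> K * hnorm H x"
      using norm R by metis
  next
    show "R \<in> carrier H \<rightarrow> carrier H"
      using R by blast
  next
    fix x y assume "x \<in> carrier H" "y \<in> carrier H"
    note xy = this
    show "R (x \<oplus>\<^bsub>H\<^esub> y) = R x \<oplus>\<^bsub>H\<^esub> R y"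
      by (rule inj) (simp_all add: xy R bounded_op_add[OF bS])
  next
    fix c x assume "x \<in> carrier H"
    note xy = this
    show "R (c \<odot>\<^bsub>H\<^esub> x) = c \<odot>\<^bsub>H\<^esub> R x"
      by (rule inj) (simp_all add: xy R bounded_op_smult[OF bS])
  qed
  then show ?thesis
    using R inj cl by blast
qed

end

section \<open>Polynomials of a self-adjoint operator and its spectrum\<close>

context complex_hilbert_space
begin

lemma smult_one_left: "x \<in> carrier H \<Longrightarrow> 1 \<odot>\<^bsub>H\<^esub> x = x"
  by (intro vec_eqI) (auto simp: cinner_simps)

lemma smult_zero_left: "x \<in> carrier H \<Longrightarrow> 0 \<odot>\<^bsub>H\<^esub> x = \<zero>\<^bsub>H\<^esub>"
  by (intro vec_eqI) (auto simp: cinner_simps)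

text \<open>
  Over the complex numbers every polynomial splits into linear factors, which real polynomials need not do.
\<close>

definition cpoly_op :: "complex poly \<Rightarrow> ('v \<Rightarrow> 'v) \<Rightarrow> 'v \<Rightarrow> 'v" where
  "cpoly_op q T x = finsum H (\<lambda>i. coeff q i \<odot>\<^bsub>H\<^esub> (T ^^ i) x) {..degree q}"

lemma poly_op_eq_cpoly_op: "poly_op H p T x = cpoly_op (map_poly complex_of_real p) T x"
  by (simp add: poly_op_def cpoly_op_def coeff_map_poly degree_map_poly)

lemma funpow_closed: "bounded_op H T \<Longrightarrow> x \<in> carrier H \<Longrightarrow> (T ^^ i) x \<in> carrier H"
  by (induction i) (auto intro: bounded_op_closed)

lemma cpoly_op_closed:
  "bounded_op H T \<Longrightarrow> x \<in> carrier H \<Longrightarrow> cpoly_op q T x \<in> carrier H"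
  unfolding cpoly_op_def by (intro M.finsum_closed) (auto simp: funpow_closed)

lemma cpoly_op_eq_finsum:
  assumes T: "bounded_op H T" and x: "x \<in> carrier H" and n: "degree q \<le> n"
  shows "cpoly_op q T x = finsum H (\<lambda>i. coeff q i \<odot>\<^bsub>H\<^esub> (T ^^ i) x) {..n}"
  using n
proof (induction n rule: dec_induct)
  case base
  then show ?case
    by (simp add: cpoly_op_def)
next
  case (step n)
  have "coeff q (Suc n) = 0"
    using step by (intro coeff_eq_0) simp
  moreover have "finsum H (\<lambda>i. coeff q i \<odot>\<^bsub>H\<^esub> (T ^^ i) x) {..n} \<in> carrier H"
    using T x by (intro M.finsum_closed) (auto simp: funpow_closed)
  moreover have "T ((T ^^ n) x) \<in> carrier H"
    using T x by (simp add: funpow_closed bounded_op_closed[OF T])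
  ultimately show ?case
    using step.IH T x by (subst M.finsum_Suc) (auto simp: funpow_closed smult_zero_left)
qed

lemma bounded_op_finsum:
  assumes T: "bounded_op H T" and f: "\<And>i. f i \<in> carrier H"
  shows "T (finsum H f {..n::nat}) = finsum H (\<lambda>i. T (f i)) {..n}"
proof (induction n)
  case 0
  then show ?case
    using T f by (simp add: bounded_op_closed[OF T])
next
  case (Suc n)
  have "finsum H f {..n} \<in> carrier H"
    using f by (intro M.finsum_closed) auto
  then show ?case
    using Suc T f by (simp add: M.finsum_Suc bounded_op_closed[OF T] bounded_op_add[OF T])
qed

lemma cpoly_op_0: "x \<in> carrier H \<Longrightarrow> cpoly_op 0 T x = \<zero>\<^bsub>H\<^esub>"
  by (simp add: cpoly_op_def smult_zero_left)

lemma cpoly_op_pCons: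
  assumes T: "bounded_op H T" and x: "x \<in> carrier H"
  shows "cpoly_op (pCons c q) T x = c \<odot>\<^bsub>H\<^esub> x \<oplus>\<^bsub>H\<^esub> T (cpoly_op q T x)"
proof -
  let ?f = "\<lambda>i. coeff q i \<odot>\<^bsub>H\<^esub> (T ^^ i) x"
  have pow: "(T ^^ i) x \<in> carrier H" for i
    using T x by (rule funpow_closed)
  have cl: "?f i \<in> carrier H" for i
    using pow by (rule smult_in)
  have eq: "coeff (pCons c q) (Suc i) \<odot>\<^bsub>H\<^esub> (T ^^ Suc i) x = T (?f i)" for i
    using T pow by (simp add: bounded_op_smult[OF T])
  have "cpoly_op (pCons c q) T x =
      finsum H (\<lambda>i. coeff (pCons c q) i \<odot>\<^bsub>H\<^esub> (T ^^ i) x) {..Suc (degree q)}"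
    using T x by (rule cpoly_op_eq_finsum) (rule degree_pCons_le)
  also have "\<dots> = finsum H (\<lambda>i. coeff (pCons c q) (Suc i) \<odot>\<^bsub>H\<^esub> (T ^^ Suc i) x) {..degree q}
      \<oplus>\<^bsub>H\<^esub> coeff (pCons c q) 0 \<odot>\<^bsub>H\<^esub> (T ^^ 0) x"
    by (rule M.finsum_Suc2) (intro funcsetI smult_in pow)
  also have "finsum H (\<lambda>i. coeff (pCons c q) (Suc i) \<odot>\<^bsub>H\<^esub> (T ^^ Suc i) x) {..degree q} =
      finsum H (\<lambda>i. T (?f i)) {..degree q}"
    unfolding eq ..
  also have "\<dots> = T (cpoly_op q T x)"
    using bounded_op_finsum[of T ?f, OF T cl] by (simp add: cpoly_op_def)
  finally show ?thesis
    using T x cpoly_op_closed[OF T x] by (simp add: M.a_comm bounded_op_closed)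
qed

lemma bounded_op_cpoly_op:
  assumes T: "bounded_op H T"
  shows "bounded_op H (cpoly_op q T)"
proof (induction q)
  case 0
  have "bounded_op H (\<lambda>x. x \<oplus>\<^bsub>H\<^esub> (- 1) \<odot>\<^bsub>H\<^esub> x)"
    by (intro bounded_op_lincomb bounded_op_ident)
  then show ?case
  proof (rule bounded_op_cong)
    fix x assume "x \<in> carrier H"
    then show "cpoly_op 0 T x = x \<oplus>\<^bsub>H\<^esub> (- 1) \<odot>\<^bsub>H\<^esub> x"
      by (intro vec_eqI) (simp_all add: cpoly_op_0 cinner_simps)
  qed
next
  case (pCons c q)
  have "bounded_op H (\<lambda>x. T (cpoly_op q T x) \<oplus>\<^bsub>H\<^esub> c \<odot>\<^bsub>H\<^esub> x)"
    by (rule bounded_op_lincomb[OF bounded_op_comp[OF T pCons.IH] bounded_op_ident])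
  then show ?case
  proof (rule bounded_op_cong)
    fix x assume x: "x \<in> carrier H"
    have "T (cpoly_op q T x) \<in> carrier H"
      by (intro bounded_op_closed[OF T] cpoly_op_closed[OF T] x)
    then show "cpoly_op (pCons c q) T x = T (cpoly_op q T x) \<oplus>\<^bsub>H\<^esub> c \<odot>\<^bsub>H\<^esub> x"
      unfolding cpoly_op_pCons[OF T x] by (intro M.a_comm smult_in x)
  qed
qed

lemma cpoly_op_const: "bounded_op H T \<Longrightarrow> x \<in> carrier H \<Longrightarrow> cpoly_op [:c:] T x = c \<odot>\<^bsub>H\<^esub> x"
  by (simp add: cpoly_op_def)

lemma cpoly_op_add:
  assumes T: "bounded_op H T" and x: "x \<in> carrier H"
  shows "cpoly_op (p + q) T x = cpoly_op p T x \<oplus>\<^bsub>H\<^esub> cpoly_op q T x"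
proof (induction p q rule: poly_induct2)
  case 0
  then show ?case
    using x by (simp add: cpoly_op_0)
next
  case (pCons a p b q)
  note [simp] = cpoly_op_closed[OF T] bounded_op_closed[OF T] x
  show ?case
    by (rule vec_eqI) (simp_all add: T pCons cpoly_op_pCons bounded_op_add[OF T] cinner_simps algebra_simps)
qed

lemma cpoly_op_smult:
  assumes T: "bounded_op H T" and x: "x \<in> carrier H"
  shows "cpoly_op (Polynomial.smult c q) T x = c \<odot>\<^bsub>H\<^esub> cpoly_op q T x"
proof (induction q)
  case 0
  then show ?case
    using x by (intro vec_eqI) (simp_all add: cpoly_op_0 cinner_simps)
next
  case (pCons a q)
  note [simp] = cpoly_op_closed[OF T] bounded_op_closed[OF T] x
  show ?case
    by (rule vec_eqI) (simp_all add: T pCons cpoly_op_pCons bounded_op_smult[OF T] cinner_simps algebra_simps)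
qed

lemma cpoly_op_mult:
  assumes T: "bounded_op H T" and x: "x \<in> carrier H"
  shows "cpoly_op (p * q) T x = cpoly_op p T (cpoly_op q T x)"
proof (induction p)
  case 0
  then show ?case
    using cpoly_op_closed[OF T x] x by (simp add: cpoly_op_0)
next
  case (pCons a p)
  note [simp] = cpoly_op_closed[OF T] bounded_op_closed[OF T] x
  show ?case
    by (rule vec_eqI) (simp_all add: T pCons cpoly_op_pCons cpoly_op_add cpoly_op_smult cinner_simps)
qed

lemma poly_op_pCons:
  assumes "bounded_op H T" "x \<in> carrier H"
  shows "poly_op H (pCons c p) T x = complex_of_real c \<odot>\<^bsub>H\<^esub> x \<oplus>\<^bsub>H\<^esub> T (poly_op H p T x)"
proof -
  have "map_poly complex_of_real (pCons c p) = pCons (complex_of_real c) (map_poly complex_of_real p)"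
    by (intro poly_eqI) (simp add: coeff_map_poly coeff_pCons split: nat.split)
  then show ?thesis
    using assms by (simp add: poly_op_eq_cpoly_op cpoly_op_pCons)
qed

lemma poly_op_closed: "bounded_op H T \<Longrightarrow> x \<in> carrier H \<Longrightarrow> poly_op H p T x \<in> carrier H"
  by (simp add: poly_op_eq_cpoly_op cpoly_op_closed)

lemma poly_op_0: "x \<in> carrier H \<Longrightarrow> poly_op H 0 T x = \<zero>\<^bsub>H\<^esub>"
  by (simp add: poly_op_eq_cpoly_op cpoly_op_0)

lemma poly_op_const:
  "bounded_op H T \<Longrightarrow> x \<in> carrier H \<Longrightarrow> poly_op H [:c:] T x = complex_of_real c \<odot>\<^bsub>H\<^esub> x"
  by (simp add: poly_op_def)

lemma poly_op_add:
  assumes "bounded_op H T" "x \<in> carrier H"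
  shows "poly_op H (p + q) T x = poly_op H p T x \<oplus>\<^bsub>H\<^esub> poly_op H q T x"
proof -
  have "map_poly complex_of_real (p + q) = map_poly complex_of_real p + map_poly complex_of_real q"
    by (intro poly_eqI) (simp add: coeff_map_poly)
  then show ?thesis
    using assms by (simp add: poly_op_eq_cpoly_op cpoly_op_add)
qed

lemma poly_op_smult:
  assumes "bounded_op H T" "x \<in> carrier H"
  shows "poly_op H (Polynomial.smult c p) T x = complex_of_real c \<odot>\<^bsub>H\<^esub> poly_op H p T x"
proof -
  have "map_poly complex_of_real (Polynomial.smult c p) = Polynomial.smult (complex_of_real c) (map_poly complex_of_real p)"
    by (intro poly_eqI) (simp add: coeff_map_poly)
  then show ?thesis
    using assms by (simp add: poly_op_eq_cpoly_op cpoly_op_smult)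
qed

lemma poly_op_diff:
  assumes "bounded_op H T" "x \<in> carrier H"
  shows "poly_op H (p - q) T x = poly_op H p T x \<ominus>\<^bsub>H\<^esub> poly_op H q T x"
proof -
  have "p - q = p + Polynomial.smult (- 1) q"
    by simp
  then have "poly_op H (p - q) T x = poly_op H p T x \<oplus>\<^bsub>H\<^esub> complex_of_real (- 1) \<odot>\<^bsub>H\<^esub> poly_op H q T x"
    using poly_op_add[OF assms, of p "Polynomial.smult (- 1) q"] poly_op_smult[OF assms, of "- 1" q] by metis
  then show ?thesis
    using poly_op_closed[OF assms] assms(2) by (intro vec_eqI) (auto simp: cinner_simps)
qed

lemma poly_op_mult:
  assumes "bounded_op H T" "x \<in> carrier H"
  shows "poly_op H (p * q) T x = poly_op H p T (poly_op H q T x)"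
proof -
  have "map_poly complex_of_real (p * q) = map_poly complex_of_real p * map_poly complex_of_real q"
    by (intro poly_eqI) (simp add: coeff_map_poly coeff_mult)
  then show ?thesis
    using assms by (simp add: poly_op_eq_cpoly_op cpoly_op_mult)
qed

lemma bounded_op_poly_op: "bounded_op H T \<Longrightarrow> bounded_op H (poly_op H p T)"
  by (rule bounded_op_cong[OF bounded_op_cpoly_op]) (simp_all add: poly_op_eq_cpoly_op)

lemma poly_op_linear:
  assumes T: "bounded_op H T" and x: "x \<in> carrier H"
  shows "poly_op H [:0, c:] T x = complex_of_real c \<odot>\<^bsub>H\<^esub> T x"
proof -
  have "T \<zero>\<^bsub>H\<^esub> = 0 \<odot>\<^bsub>H\<^esub> T \<zero>\<^bsub>H\<^esub>"
    using bounded_op_smult[OF T, of "\<zero>\<^bsub>H\<^esub>" 0] by (simp add: smult_zero_left)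
  also have "\<dots> = \<zero>\<^bsub>H\<^esub>"
    by (rule smult_zero_left) (simp add: bounded_op_closed[OF T])
  finally have "T \<zero>\<^bsub>H\<^esub> = \<zero>\<^bsub>H\<^esub>" .
  then show ?thesis
    using x bounded_op_closed[OF T x]
    by (simp add: T poly_op_pCons poly_op_0 smult_zero_left bounded_op_smult[OF T])
qed

lemma poly_op_commute:
  assumes "bounded_op H T" "x \<in> carrier H"
  shows "poly_op H p T (T x) = T (poly_op H p T x)"
proof -
  have X: "poly_op H [:0, 1:] T y = T y" if "y \<in> carrier H" for y
    using poly_op_linear[OF assms(1) that, of 1] bounded_op_closed[OF assms(1) that]
    by (simp add: smult_one_left)
  have "poly_op H p T (T x) = poly_op H (p * [:0, 1:]) T x"
    using assms by (simp only: poly_op_mult X)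
  also have "\<dots> = poly_op H ([:0, 1:] * p) T x"
    by (simp only: mult.commute)
  also have "\<dots> = T (poly_op H p T x)"
    using assms by (simp only: poly_op_mult X poly_op_closed)
  finally show ?thesis .
qed

lemma self_adjoint_poly_op:
  assumes A: "self_adjoint_op H A"
  shows "self_adjoint_op H (poly_op H p A)"
proof -
  note bA = self_adjoint_bounded[OF A]
  note [simp] = self_adjoint_closed[OF A] poly_op_closed[OF bA]
  have "cinner H (poly_op H p A x) y = cinner H x (poly_op H p A y)"
    if "x \<in> carrier H" "y \<in> carrier H" for x y
    using that
  proof (induction p arbitrary: x y)
    case 0
    then show ?case
      by (simp add: poly_op_0)
  next
    case (pCons c p)
    have "cinner H (A (poly_op H p A x)) y = cinner H (poly_op H p A x) (A y)"
      using A pCons.prems by (simp add: self_adjoint_op_def)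
    also have "\<dots> = cinner H x (A (poly_op H p A y))"
      using pCons.IH[of x "A y"] pCons.prems by (simp add: poly_op_commute[OF bA])
    finally show ?case
      using pCons.prems by (simp add: bA poly_op_pCons cinner_simps)
  qed
  then show ?thesis
    using bounded_op_poly_op[OF bA] by (simp add: self_adjoint_op_def)
qed

text \<open>
  That is, \<open>T\<close> is not bounded below. The strict inequality excludes the zero vector.
\<close>

definition approximate_kernel :: "('v \<Rightarrow> 'v) \<Rightarrow> bool" where
  "approximate_kernel T \<longleftrightarrow> (\<forall>e>0. \<exists>x\<in>carrier H. hnorm H (T x) < e * hnorm H x)"

lemma approximate_kernel_cong:
  assumes "approximate_kernel S" "\<And>x. x \<in> carrier H \<Longrightarrow> S x = T x"
  shows "approximate_kernel T"
  using assms unfolding approximate_kernel_def by metis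

lemma approximate_kernel_imp_spectrum:
  assumes "approximate_kernel (\<lambda>x. A x \<ominus>\<^bsub>H\<^esub> z \<odot>\<^bsub>H\<^esub> x)" and A: "bounded_op H A"
  shows "z \<in> spectrum_op H A"
proof (rule ccontr)
  assume "z \<notin> spectrum_op H A"
  then obtain R where R: "bounded_op H R"
      "\<And>x. x \<in> carrier H \<Longrightarrow> R (A x \<ominus>\<^bsub>H\<^esub> z \<odot>\<^bsub>H\<^esub> x) = x"
    by (auto simp: spectrum_op_def diff_op_def scalar_op_def)
  obtain K where K: "K > 0" "\<And>x. x \<in> carrier H \<Longrightarrow> hnorm H (R x) \<le> K * hnorm H x"
    using R(1) by (rule bounded_op_bound) blast
  obtain x where x: "x \<in> carrier H" "hnorm H (A x \<ominus>\<^bsub>H\<^esub> z \<odot>\<^bsub>H\<^esub> x) < 1 / K * hnorm H x"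
    using assms(1) K(1) unfolding approximate_kernel_def by (metis zero_less_divide_1_iff)
  then have "K * hnorm H (A x \<ominus>\<^bsub>H\<^esub> z \<odot>\<^bsub>H\<^esub> x) < hnorm H x"
    using K(1) by (simp add: field_simps)
  moreover have "hnorm H x \<le> K * hnorm H (A x \<ominus>\<^bsub>H\<^esub> z \<odot>\<^bsub>H\<^esub> x)"
    using K(2)[of "A x \<ominus>\<^bsub>H\<^esub> z \<odot>\<^bsub>H\<^esub> x"] R(2) x A by (simp add: bounded_op_closed[OF A])
  ultimately show False
    by simp
qed

text \<open>
  The imaginary part of \<open>\<langle>(A - z) x, x\<rangle>\<close> is \<open>- Im z \<parallel>x\<parallel>\<^sup>2\<close>, so \<open>A - z\<close> is bounded below by \<open>|Im z|\<close>.
\<close>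

lemma approximate_eigenvalue_real:
  assumes "approximate_kernel (\<lambda>x. A x \<ominus>\<^bsub>H\<^esub> z \<odot>\<^bsub>H\<^esub> x)" and A: "self_adjoint_op H A"
  shows "Im z = 0"
proof (rule ccontr)
  assume "Im z \<noteq> 0"
  then obtain x where x: "x \<in> carrier H" "hnorm H (A x \<ominus>\<^bsub>H\<^esub> z \<odot>\<^bsub>H\<^esub> x) < \<bar>Im z\<bar> * hnorm H x"
    using assms(1) unfolding approximate_kernel_def by (metis zero_less_abs_iff)
  let ?y = "A x \<ominus>\<^bsub>H\<^esub> z \<odot>\<^bsub>H\<^esub> x"
  have y: "?y \<in> carrier H"
    using x self_adjoint_closed[OF A] by simp
  have "Im (cinner H (A x) x) = 0"
    using self_adjoint_form[OF A x(1)] by (metis Im_complex_of_real)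
  then have "Im (cinner H ?y x) = - Im z * (hnorm H x)\<^sup>2"
    using x self_adjoint_closed[OF A] by (simp add: cinner_simps cinner_self)
  then have "\<bar>Im z\<bar> * (hnorm H x)\<^sup>2 = \<bar>Im (cinner H ?y x)\<bar>"
    by (simp add: abs_mult)
  also have "\<dots> \<le> hnorm H ?y * hnorm H x"
    using Cauchy_Schwarz[OF y x(1)] abs_Im_le_cmod[of "cinner H ?y x"] by simp
  finally have "\<bar>Im z\<bar> * (hnorm H x)\<^sup>2 \<le> hnorm H ?y * hnorm H x" .
  moreover have "hnorm H x > 0"
  proof (rule ccontr)
    assume "\<not> hnorm H x > 0"
    then have "hnorm H x = 0"
      using hnorm_ge_0[OF x(1)] by linarith
    then show False
      using x(2) hnorm_ge_0[OF y] by simp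
  qed
  ultimately show False
    using x(2) by (simp add: sq_eq_mult flip: mult.assoc)
qed

text \<open>
  If \<open>A - z\<close> is bounded below, it can be cancelled from a factorization of \<open>q(A)\<close>; so one of the
  linear factors of \<open>q(A)\<close> is responsible when \<open>q(A)\<close> is not bounded below.
\<close>

lemma approximate_kernel_cpoly_op:
  assumes A: "bounded_op H A" and "q \<noteq> 0" "approximate_kernel (cpoly_op q A)"
  shows "\<exists>z. poly q z = 0 \<and> approximate_kernel (\<lambda>x. A x \<ominus>\<^bsub>H\<^esub> z \<odot>\<^bsub>H\<^esub> x)"
  using assms(2,3)
proof (induction "degree q" arbitrary: q)
  case 0
  then obtain c where q: "q = [:c:]"
    by (metis degree_eq_zeroE)
  then obtain x where "x \<in> carrier H" "hnorm H (cpoly_op q A x) < cmod c * hnorm H x"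
    using 0 unfolding approximate_kernel_def by (metis pCons_0_0 zero_less_norm_iff)
  then show ?case
    by (simp add: q A cpoly_op_const hnorm_smult)
next
  case (Suc n)
  then have "\<not> constant (poly q)"
    by (simp add: constant_degree)
  then obtain z where z: "poly q z = 0"
    using fundamental_theorem_of_algebra by blast
  then obtain q' where q: "q = [:- z, 1:] * q'"
    by (metis dvd_def poly_eq_0_iff_dvd)
  have q': "q' \<noteq> 0" "n = degree q'"
  proof -
    show "q' \<noteq> 0"
      using q Suc.prems(1) by auto
    then have "degree q = Suc (degree q')"
      unfolding q by (subst degree_mult_eq) auto
    then show "n = degree q'"
      using Suc.hyps(2) by simp
  qed
  have factor: "cpoly_op q A x = A (cpoly_op q' A x) \<ominus>\<^bsub>H\<^esub> z \<odot>\<^bsub>H\<^esub> cpoly_op q' A x"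
    if "x \<in> carrier H" for x
  proof -
    have *: "cpoly_op [:- z, 1:] A y = A y \<ominus>\<^bsub>H\<^esub> z \<odot>\<^bsub>H\<^esub> y" if "y \<in> carrier H" for y
    proof -
      have "cpoly_op [:- z, 1:] A y = (- z) \<odot>\<^bsub>H\<^esub> y \<oplus>\<^bsub>H\<^esub> A y"
        unfolding cpoly_op_pCons[OF A that, of "- z"] cpoly_op_const[OF A that] smult_one_left[OF that] ..
      then show ?thesis
        using that bounded_op_closed[OF A that] by (intro vec_eqI) (simp_all add: cinner_simps)
    qed
    show ?thesis
      unfolding q using that A by (simp only: cpoly_op_mult * cpoly_op_closed)
  qed
  show ?case
  proof (cases "approximate_kernel (\<lambda>x. A x \<ominus>\<^bsub>H\<^esub> z \<odot>\<^bsub>H\<^esub> x)")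
    case False
    then obtain d where d: "d > 0"
        "\<And>y. y \<in> carrier H \<Longrightarrow> d * hnorm H y \<le> hnorm H (A y \<ominus>\<^bsub>H\<^esub> z \<odot>\<^bsub>H\<^esub> y)"
      unfolding approximate_kernel_def by (metis not_less)
    have "approximate_kernel (cpoly_op q' A)"
      unfolding approximate_kernel_def
    proof (intro allI impI)
      fix e :: real assume "e > 0"
      then obtain x where x: "x \<in> carrier H" "hnorm H (cpoly_op q A x) < (d * e) * hnorm H x"
        using Suc.prems(2) d(1) unfolding approximate_kernel_def by (metis mult_pos_pos)
      then have "d * hnorm H (cpoly_op q' A x) < d * (e * hnorm H x)"
        using d(2)[of "cpoly_op q' A x"] A by (simp add: factor cpoly_op_closed)
      then show "\<exists>x\<in>carrier H. hnorm H (cpoly_op q' A x) < e * hnorm H x"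
        using x(1) d(1) by auto
    qed
    then show ?thesis
      using Suc.hyps(1)[OF q'(2,1)] q by auto
  qed (use z in blast)
qed

text \<open>
  With \<open>D = S - \<mu> \<ge> 0\<close> for the infimum \<open>\<mu>\<close> of the Rayleigh quotient \<open>g\<close>, the estimate
  \<open>\<parallel>D x\<parallel>\<^sup>2 \<le> r \<langle>D x, x\<rangle>\<close> shows that near-minimizers of \<open>g\<close> are nearly annihilated by \<open>D\<close>.
\<close>

lemma ex_form_infimum:
  assumes S: "self_adjoint_op H S"
  shows "\<exists>\<mu>::real. (\<forall>x\<in>carrier H. \<mu> * (hnorm H x)\<^sup>2 \<le> Re (cinner H (S x) x)) \<and>
    approximate_kernel (\<lambda>x. S x \<ominus>\<^bsub>H\<^esub> complex_of_real \<mu> \<odot>\<^bsub>H\<^esub> x)"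
proof -
  note cl [simp] = self_adjoint_closed[OF S]
  obtain K where K: "K > 0" "\<And>x. x \<in> carrier H \<Longrightarrow> hnorm H (S x) \<le> K * hnorm H x"
    using self_adjoint_bounded[OF S] by (rule bounded_op_bound) blast
  have form: "\<bar>Re (cinner H (S x) x)\<bar> \<le> K * (hnorm H x)\<^sup>2" if x: "x \<in> carrier H" for x
  proof -
    have "\<bar>Re (cinner H (S x) x)\<bar> \<le> hnorm H (S x) * hnorm H x"
      using Cauchy_Schwarz[of "S x" x] abs_Re_le_cmod[of "cinner H (S x) x"] x by simp
    also have "\<dots> \<le> (K * hnorm H x) * hnorm H x"
      using K(2)[OF x] x by (intro mult_right_mono) auto
    finally show ?thesis
      by (simp add: sq_eq_mult mult.assoc)
  qed
  define g where "g x = Re (cinner H (S x) x) / (hnorm H x)\<^sup>2" for x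
  define Q where "Q = g ` {x \<in> carrier H. hnorm H x > 0}"
  have Q: "Q \<noteq> {}" "bdd_below Q"
  proof -
    show "Q \<noteq> {}"
    proof -
      obtain x where "x \<in> carrier H" "hnorm H x > 0"
        by (rule ex_nonzero)
      then show ?thesis
        unfolding Q_def by blast
    qed
    have "- K \<le> q" if qQ: "q \<in> Q" for q
    proof -
      obtain x where x: "x \<in> carrier H" "hnorm H x > 0" and q: "q = g x"
        using qQ unfolding Q_def by blast
      have "- K * (hnorm H x)\<^sup>2 \<le> Re (cinner H (S x) x)"
        using form[OF x(1)] by simp
      then show ?thesis
        unfolding q g_def using x(2) by (subst le_divide_eq) simp
    qed
    then show "bdd_below Q"
      by (rule bdd_belowI)
  qed
  define \<mu> where "\<mu> = Inf Q"
  have lower: "\<mu> * (hnorm H x)\<^sup>2 \<le> Re (cinner H (S x) x)" if x: "x \<in> carrier H" for x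
  proof (cases "hnorm H x = 0")
    case True
    then show ?thesis
      using form[OF x] by simp
  next
    case False
    then have pos: "hnorm H x > 0"
      using hnorm_ge_0[OF x] by linarith
    then have "\<mu> \<le> g x"
      unfolding \<mu>_def using x Q(2) by (intro cInf_lower) (auto simp: Q_def)
    then show ?thesis
      using pos by (simp add: g_def le_divide_eq)
  qed
  define D where "D x = S x \<oplus>\<^bsub>H\<^esub> complex_of_real (- \<mu>) \<odot>\<^bsub>H\<^esub> x" for x
  have D: "self_adjoint_op H D"
    unfolding D_def[abs_def] using S self_adjoint_ident by (rule self_adjoint_lincomb)
  have D_eq: "D x = S x \<ominus>\<^bsub>H\<^esub> complex_of_real \<mu> \<odot>\<^bsub>H\<^esub> x" if "x \<in> carrier H" for x
    using that unfolding D_def by (intro vec_eqI) (auto simp: cinner_simps)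
  have formD: "Re (cinner H (D x) x) = Re (cinner H (S x) x) - \<mu> * (hnorm H x)\<^sup>2"
    if "x \<in> carrier H" for x
    using that by (simp add: D_def cinner_simps hnorm_sq)
  define r where "r = K + \<bar>\<mu>\<bar>"
  have "r > 0"
    using K(1) by (simp add: r_def)
  have posD: "0 \<le> Re (cinner H (D x) x)" if "x \<in> carrier H" for x
    using formD[OF that] lower[OF that] by simp
  have leD: "Re (cinner H (D x) x) \<le> r * (hnorm H x)\<^sup>2" if x: "x \<in> carrier H" for x
  proof -
    have "- \<mu> * (hnorm H x)\<^sup>2 \<le> \<bar>\<mu>\<bar> * (hnorm H x)\<^sup>2"
      by (intro mult_right_mono) auto
    then show ?thesis
      using formD[OF x] form[OF x] by (simp add: r_def algebra_simps)
  qed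
  have "approximate_kernel D"
    unfolding approximate_kernel_def
  proof (intro allI impI)
    fix e :: real assume "e > 0"
    then have "Inf Q < \<mu> + e\<^sup>2 / r"
      using \<open>r > 0\<close> by (simp add: \<mu>_def)
    then obtain q where "q \<in> Q" "q < \<mu> + e\<^sup>2 / r"
      using cInf_lessD[OF Q(1)] by blast
    then obtain x where x: "x \<in> carrier H" "hnorm H x > 0"
        and q: "Re (cinner H (S x) x) / (hnorm H x)\<^sup>2 < \<mu> + e\<^sup>2 / r"
      unfolding Q_def g_def by blast
    have "Re (cinner H (S x) x) < (\<mu> + e\<^sup>2 / r) * (hnorm H x)\<^sup>2"
      using q x(2) by (simp add: divide_less_eq)
    then have "Re (cinner H (D x) x) < e\<^sup>2 / r * (hnorm H x)\<^sup>2"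
      using formD[OF x(1)] by (simp add: algebra_simps)
    then have "r * Re (cinner H (D x) x) < e\<^sup>2 * (hnorm H x)\<^sup>2"
      using \<open>r > 0\<close> by (simp add: field_simps)
    moreover have "(hnorm H (D x))\<^sup>2 \<le> r * Re (cinner H (D x) x)"
      using D posD leD x(1) by (rule positive_hnorm_le)
    ultimately have "(hnorm H (D x))\<^sup>2 < (e * hnorm H x)\<^sup>2"
      by (simp add: power_mult_distrib)
    then have "hnorm H (D x) < e * hnorm H x"
      by (rule power2_less_imp_less) (use \<open>e > 0\<close> x in simp)
    then show "\<exists>x\<in>carrier H. hnorm H (D x) < e * hnorm H x"
      using x by blast
  qed
  then have "approximate_kernel (\<lambda>x. S x \<ominus>\<^bsub>H\<^esub> complex_of_real \<mu> \<odot>\<^bsub>H\<^esub> x)"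
    by (rule approximate_kernel_cong) (rule D_eq)
  then show ?thesis
    using lower by blast
qed

text \<open>
  The infimum of the form of \<open>p(A)\<close> is a value of \<open>p\<close> on the spectrum: it is an approximate
  eigenvalue of \<open>p(A)\<close>, and those come from approximate eigenvalues of \<open>A\<close>.
\<close>

lemma poly_op_form_attained_on_spectrum:
  assumes A: "self_adjoint_op H A"
  shows "\<exists>t. complex_of_real t \<in> spectrum_op H A \<and>
    (\<forall>x\<in>carrier H. poly p t * (hnorm H x)\<^sup>2 \<le> Re (cinner H (poly_op H p A x) x))"
proof -
  note bA = self_adjoint_bounded[OF A]
  obtain \<mu> where lower: "\<forall>x\<in>carrier H. \<mu> * (hnorm H x)\<^sup>2 \<le> Re (cinner H (poly_op H p A x) x)"
      and ker: "approximate_kernel (\<lambda>x. poly_op H p A x \<ominus>\<^bsub>H\<^esub> complex_of_real \<mu> \<odot>\<^bsub>H\<^esub> x)"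
    using ex_form_infimum[OF self_adjoint_poly_op[OF A]] by blast
  \<comment> \<open>If \<open>p - \<mu>\<close> vanishes, it has no linear factors, but then every point of the spectrum will do.\<close>
  have "\<exists>t. complex_of_real t \<in> spectrum_op H A \<and> poly p t = \<mu>"
  proof (cases "p = [:\<mu>:]")
    case True
    obtain t where "approximate_kernel (\<lambda>x. A x \<ominus>\<^bsub>H\<^esub> complex_of_real t \<odot>\<^bsub>H\<^esub> x)"
      using ex_form_infimum[OF A] by blast
    then show ?thesis
      using True approximate_kernel_imp_spectrum[OF _ bA] by auto
  next
    case False
    define q where "q = map_poly complex_of_real (p - [:\<mu>:])"
    have "q \<noteq> 0"
      using False by (auto simp: q_def poly_eq_iff coeff_map_poly)
    have "approximate_kernel (cpoly_op q A)"
      by (rule approximate_kernel_cong[OF ker])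
        (simp add: bA q_def poly_op_diff poly_op_const flip: poly_op_eq_cpoly_op)
    then obtain z where z: "poly q z = 0" "approximate_kernel (\<lambda>x. A x \<ominus>\<^bsub>H\<^esub> z \<odot>\<^bsub>H\<^esub> x)"
      using approximate_kernel_cpoly_op[OF bA \<open>q \<noteq> 0\<close>] by blast
    have "z = complex_of_real (Re z)"
      using approximate_eigenvalue_real[OF z(2) A] by (simp add: complex_eq_iff)
    moreover have "poly (map_poly complex_of_real r) (complex_of_real t) = complex_of_real (poly r t)"
      for r :: "real poly" and t
      by (induction r) (auto simp: map_poly_pCons)
    ultimately have "poly p (Re z) = \<mu>"
      using z(1) unfolding q_def
      by (metis add.right_neutral eq_iff_diff_eq_0 mult_zero_right of_real_eq_0_iff poly_0 poly_diff poly_pCons)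
    then show ?thesis
      using approximate_kernel_imp_spectrum[OF z(2) bA] \<open>z = complex_of_real (Re z)\<close> by metis
  qed
  then show ?thesis
    using lower by blast
qed

lemma poly_op_form_ge:
  assumes A: "self_adjoint_op H A"
    and p: "\<And>t. complex_of_real t \<in> spectrum_op H A \<Longrightarrow> c \<le> poly p t"
    and x: "x \<in> carrier H"
  shows "c * (hnorm H x)\<^sup>2 \<le> Re (cinner H (poly_op H p A x) x)"
proof -
  obtain t where t: "complex_of_real t \<in> spectrum_op H A"
      "poly p t * (hnorm H x)\<^sup>2 \<le> Re (cinner H (poly_op H p A x) x)"
    using poly_op_form_attained_on_spectrum[OF A] x by blast
  have "c * (hnorm H x)\<^sup>2 \<le> poly p t * (hnorm H x)\<^sup>2"
    using p[OF t(1)] by (intro mult_right_mono) auto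
  then show ?thesis
    using t(2) by linarith
qed

text \<open>
  Apply the lower bound to \<open>- p\<^sup>2\<close>, whose form at \<open>x\<close> is \<open>- \<parallel>p(A) x\<parallel>\<^sup>2\<close>.
\<close>

lemma hnorm_poly_op_le:
  assumes A: "self_adjoint_op H A"
    and p: "\<And>t. complex_of_real t \<in> spectrum_op H A \<Longrightarrow> \<bar>poly p t\<bar> \<le> c"
    and x: "x \<in> carrier H"
  shows "hnorm H (poly_op H p A x) \<le> c * hnorm H x"
proof -
  note bA = self_adjoint_bounded[OF A]
  note cl = poly_op_closed[OF bA]
  have "0 \<le> c"
    using poly_op_form_attained_on_spectrum[OF A] p abs_ge_zero order_trans by blast
  have "- c\<^sup>2 \<le> poly (- (p * p)) t" if "complex_of_real t \<in> spectrum_op H A" for t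
    using power_mono[OF p[OF that], of 2] by (simp add: sq_eq_mult)
  then have "- c\<^sup>2 * (hnorm H x)\<^sup>2 \<le> Re (cinner H (poly_op H (- (p * p)) A x) x)"
    using A x by (intro poly_op_form_ge)
  also have "poly_op H (- (p * p)) A x = complex_of_real (- 1) \<odot>\<^bsub>H\<^esub> poly_op H p A (poly_op H p A x)"
    using poly_op_smult[OF bA x, of "- 1" "p * p"] poly_op_mult[OF bA x] by simp
  also have "cinner H \<dots> x = - cinner H (poly_op H p A x) (poly_op H p A x)"
  proof -
    have "cinner H (poly_op H p A (poly_op H p A x)) x = cinner H (poly_op H p A x) (poly_op H p A x)"
      using self_adjoint_poly_op[OF A, of p] x cl[OF x] unfolding self_adjoint_op_def by blast
    then show ?thesis
      using x cl by (simp add: cinner_smult_left)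
  qed
  finally have "(hnorm H (poly_op H p A x))\<^sup>2 \<le> (c * hnorm H x)\<^sup>2"
    using x cl by (simp add: hnorm_sq power_mult_distrib)
  then show ?thesis
    by (rule power2_le_imp_le) (use \<open>0 \<le> c\<close> x in simp)
qed

lemma not_in_spectrum_below:
  assumes A: "self_adjoint_op H A" and "t < l"
    and l: "\<And>x. x \<in> carrier H \<Longrightarrow> l * (hnorm H x)\<^sup>2 \<le> Re (cinner H (A x) x)"
  shows "complex_of_real t \<notin> spectrum_op H A"
proof -
  note [simp] = self_adjoint_closed[OF A]
  let ?S = "\<lambda>x. A x \<oplus>\<^bsub>H\<^esub> complex_of_real (- t) \<odot>\<^bsub>H\<^esub> x"
  have S: "?S x = diff_op H A (scalar_op H (complex_of_real t)) x" if "x \<in> carrier H" for x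
    using that unfolding diff_op_def scalar_op_def by (intro vec_eqI) (auto simp: cinner_simps)
  have "\<exists>R. bounded_op H R \<and> (\<forall>x\<in>carrier H. R (?S x) = x \<and> ?S (R x) = x)"
  proof (rule bounded_below_invertible)
    show "self_adjoint_op H ?S"
      using A self_adjoint_ident by (rule self_adjoint_lincomb)
    show "l - t > 0"
      using \<open>t < l\<close> by simp
    show "(l - t) * (hnorm H x)\<^sup>2 \<le> Re (cinner H (?S x) x)" if "x \<in> carrier H" for x
      using l[OF that] that by (simp add: cinner_simps hnorm_sq algebra_simps)
  qed
  then obtain R where R: "bounded_op H R" "\<And>x. x \<in> carrier H \<Longrightarrow> R (?S x) = x"
      "\<And>x. x \<in> carrier H \<Longrightarrow> ?S (R x) = x"
    by blast
  let ?D = "diff_op H A (scalar_op H (complex_of_real t))"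
  have "R (?D x) = x \<and> ?D (R x) = x" if x: "x \<in> carrier H" for x
    using R(2,3)[OF x] S[OF x] S[OF bounded_op_closed[OF R(1) x]] by simp
  then show ?thesis
    using R(1) unfolding spectrum_op_def by blast
qed

lemma not_in_spectrum_above:
  assumes A: "self_adjoint_op H A" and "u < t"
    and u: "\<And>x. x \<in> carrier H \<Longrightarrow> Re (cinner H (A x) x) \<le> u * (hnorm H x)\<^sup>2"
  shows "complex_of_real t \<notin> spectrum_op H A"
proof -
  note [simp] = self_adjoint_closed[OF A]
  let ?S = "\<lambda>x. (x \<oplus>\<^bsub>H\<^esub> complex_of_real (t - 1) \<odot>\<^bsub>H\<^esub> x) \<oplus>\<^bsub>H\<^esub> complex_of_real (- 1) \<odot>\<^bsub>H\<^esub> A x"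
  let ?D = "diff_op H A (scalar_op H (complex_of_real t))"
  have S: "?D x = - 1 \<odot>\<^bsub>H\<^esub> ?S x" if "x \<in> carrier H" for x
    using that unfolding diff_op_def scalar_op_def
    by (intro vec_eqI) (auto simp: cinner_simps algebra_simps)
  have saS: "self_adjoint_op H ?S"
    using A by (intro self_adjoint_lincomb self_adjoint_ident)
  have "\<exists>R. bounded_op H R \<and> (\<forall>x\<in>carrier H. R (?S x) = x \<and> ?S (R x) = x)"
  proof (rule bounded_below_invertible[OF saS])
    show "t - u > 0"
      using \<open>u < t\<close> by simp
    show "(t - u) * (hnorm H x)\<^sup>2 \<le> Re (cinner H (?S x) x)" if "x \<in> carrier H" for x
      using u[OF that] that by (simp add: cinner_simps hnorm_sq algebra_simps)
  qed
  then obtain R where R: "bounded_op H R" "\<And>x. x \<in> carrier H \<Longrightarrow> R (?S x) = x"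
      "\<And>x. x \<in> carrier H \<Longrightarrow> ?S (R x) = x"
    by blast
  let ?R = "\<lambda>x. scalar_op H (- 1) (R x)"
  have neg: "- 1 \<odot>\<^bsub>H\<^esub> (- 1 \<odot>\<^bsub>H\<^esub> x) = x" if "x \<in> carrier H" for x
    using that by (intro vec_eqI) (auto simp: cinner_simps)
  have "bounded_op H ?R"
    using bounded_op_scalar_op R(1) by (rule bounded_op_comp)
  moreover have "?R (?D x) = x" if x: "x \<in> carrier H" for x
  proof -
    have "R (?D x) = - 1 \<odot>\<^bsub>H\<^esub> x"
      by (simp only: S[OF x] bounded_op_smult[OF R(1) self_adjoint_closed[OF saS x]] R(2)[OF x])
    then show ?thesis
      using x by (simp only: scalar_op_def neg)
  qed
  moreover have "?D (?R x) = x" if x: "x \<in> carrier H" for x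
  proof -
    have "?S (?R x) = - 1 \<odot>\<^bsub>H\<^esub> ?S (R x)"
      unfolding scalar_op_def using self_adjoint_bounded[OF saS] bounded_op_closed[OF R(1) x]
      by (rule bounded_op_smult)
    moreover have "?D (?R x) = - 1 \<odot>\<^bsub>H\<^esub> ?S (?R x)"
      by (rule S) (simp add: scalar_op_def bounded_op_closed[OF R(1) x])
    ultimately show ?thesis
      using x by (simp only: R(3)[OF x] neg)
  qed
  ultimately show ?thesis
    unfolding spectrum_op_def by blast
qed

text \<open>
  The infima of the forms of \<open>A\<close> and \<open>- A\<close> are attained on the spectrum, and beyond the numerical range
  \<open>A - t\<close> or \<open>t - A\<close> is bounded below, hence invertible. So the spectrum has a greatest real point,
  and its real points lie in a compact interval with ends in the spectrum, on which the Weierstrass theorem applies.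
\<close>

lemma spectrum_hull:
  assumes A: "self_adjoint_op H A"
  obtains l where "complex_of_real l \<in> spectrum_op H A"
    "complex_of_real (max_spectrum H A) \<in> spectrum_op H A"
    "\<And>t. complex_of_real t \<in> spectrum_op H A \<Longrightarrow> l \<le> t \<and> t \<le> max_spectrum H A"
    "\<And>x. x \<in> carrier H \<Longrightarrow> Re (cinner H (A x) x) \<le> max_spectrum H A * (hnorm H x)\<^sup>2"
proof -
  note bA = self_adjoint_bounded[OF A]
  note [simp] = self_adjoint_closed[OF A]
  have X: "poly_op H [:0, c:] A x = complex_of_real c \<odot>\<^bsub>H\<^esub> A x" if "x \<in> carrier H" for x c
    using bA that by (rule poly_op_linear)
  obtain l where l: "complex_of_real l \<in> spectrum_op H A"
      "\<And>x. x \<in> carrier H \<Longrightarrow> l * (hnorm H x)\<^sup>2 \<le> Re (cinner H (A x) x)"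
    using poly_op_form_attained_on_spectrum[OF A, of "[:0, 1:]"]
    by (auto simp: X smult_one_left)
  obtain u where u: "complex_of_real u \<in> spectrum_op H A"
      "\<And>x. x \<in> carrier H \<Longrightarrow> Re (cinner H (A x) x) \<le> u * (hnorm H x)\<^sup>2"
    using poly_op_form_attained_on_spectrum[OF A, of "[:0, - 1:]"] by (auto simp: X cinner_simps)
  have hull: "l \<le> t \<and> t \<le> u" if "complex_of_real t \<in> spectrum_op H A" for t
    using that not_in_spectrum_below[OF A _ l(2), of t] not_in_spectrum_above[OF A _ u(2), of t]
    by force
  have "max_spectrum H A = u"
    unfolding max_spectrum_def using u(1) hull by (intro Greatest_equality) auto
  then show ?thesis
    using that[OF l(1)] u hull by blast
qed

end

section \<open>Continuous functional calculus\<close>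

lemma Weierstrass_polys:
  fixes f :: "real \<Rightarrow> real"
  assumes "continuous_on {l..u} f"
  obtains p :: "nat \<Rightarrow> real poly" where "uniform_limit {l..u} (\<lambda>n. poly (p n)) f sequentially"
proof -
  have "\<exists>p::real poly. \<forall>x\<in>{l..u}. \<bar>f x - poly p x\<bar> < e" if e: "e > 0" for e
  proof -
    obtain g where g: "real_polynomial_function g" "\<And>x. x \<in> {l..u} \<Longrightarrow> \<bar>f x - g x\<bar> < e"
      using Stone_Weierstrass_real_polynomial_function[OF compact_Icc assms e] by blast
    obtain a n where a: "g = (\<lambda>x. \<Sum>i\<le>n. a i * x ^ i)"
      using g(1) real_polynomial_function_iff_sum by blast
    have "poly (\<Sum>i\<le>n. monom (a i) i) x = g x" for x
      by (simp add: a poly_sum poly_monom)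
    then show ?thesis
      using g(2) by metis
  qed
  then have "\<forall>n. \<exists>p::real poly. \<forall>x\<in>{l..u}. \<bar>f x - poly p x\<bar> < 1 / real (Suc n)"
    by simp
  then obtain p :: "nat \<Rightarrow> real poly"
    where p: "\<And>n x. x \<in> {l..u} \<Longrightarrow> \<bar>f x - poly (p n) x\<bar> < 1 / real (Suc n)"
    by metis
  have "uniform_limit {l..u} (\<lambda>n. poly (p n)) f sequentially"
    unfolding uniform_limit_sequentially_iff
  proof (intro allI impI)
    fix e :: real assume "e > 0"
    then obtain N where N: "1 / real (Suc N) < e"
      using nat_approx_posE by blast
    have "dist (poly (p n) x) (f x) < e" if "n \<ge> N" "x \<in> {l..u}" for n x
    proof -
      have "1 / real (Suc n) \<le> 1 / real (Suc N)"
        using that by (simp add: field_simps)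
      then show ?thesis
        using p[OF that(2), of n] N by (simp add: dist_real_def abs_minus_commute)
    qed
    then show "\<exists>N. \<forall>n\<ge>N. \<forall>x\<in>{l..u}. dist (poly (p n) x) (f x) < e"
      by blast
  qed
  then show ?thesis
    by (rule that)
qed

context complex_hilbert_space
begin

definition real_spectrum :: "('v \<Rightarrow> 'v) \<Rightarrow> real set" where
  "real_spectrum A = {t. complex_of_real t \<in> spectrum_op H A}"

definition vec_tendsto :: "(nat \<Rightarrow> 'v) \<Rightarrow> 'v \<Rightarrow> bool" where
  "vec_tendsto s x \<longleftrightarrow> (\<lambda>n. hnorm H (s n \<ominus>\<^bsub>H\<^esub> x)) \<longlonglongrightarrow> 0"

lemma vec_tendstoI:
  assumes "\<And>n. s n \<in> carrier H" "x \<in> carrier H"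
    and "\<And>n. hnorm H (s n \<ominus>\<^bsub>H\<^esub> x) \<le> c n" "c \<longlonglongrightarrow> 0"
  shows "vec_tendsto s x"
  unfolding vec_tendsto_def
  by (rule tendsto_sandwich[OF _ _ tendsto_const assms(4)]) (use assms in auto)

lemma vec_tendsto_unique:
  assumes s: "\<And>n. s n \<in> carrier H" and x: "x \<in> carrier H" and y: "y \<in> carrier H"
    and "vec_tendsto s x" "vec_tendsto s y"
  shows "x = y"
proof -
  have "hnorm H (x \<ominus>\<^bsub>H\<^esub> y) \<le> hnorm H (s n \<ominus>\<^bsub>H\<^esub> x) + hnorm H (s n \<ominus>\<^bsub>H\<^esub> y)" for n
    using hnorm_triangle[OF x s y, of n] hnorm_minus_commute[OF x s, of n] by simp
  moreover have "(\<lambda>n. hnorm H (s n \<ominus>\<^bsub>H\<^esub> x) + hnorm H (s n \<ominus>\<^bsub>H\<^esub> y)) \<longlonglongrightarrow> 0 + 0"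
    using assms(4,5) unfolding vec_tendsto_def by (rule tendsto_add)
  ultimately have "hnorm H (x \<ominus>\<^bsub>H\<^esub> y) \<le> 0"
    using LIMSEQ_le_const by fastforce
  then have "hnorm H (x \<ominus>\<^bsub>H\<^esub> y) = 0"
    using hnorm_ge_0[OF M.minus_closed[OF x y]] by linarith
  then show ?thesis
    using x y by (simp add: hnorm_diff_eq_0_iff)
qed

lemma vec_tendsto_add:
  assumes "\<And>n. s n \<in> carrier H" "\<And>n. r n \<in> carrier H" "x \<in> carrier H" "y \<in> carrier H"
    and lim: "vec_tendsto s x" "vec_tendsto r y"
  shows "vec_tendsto (\<lambda>n. s n \<oplus>\<^bsub>H\<^esub> r n) (x \<oplus>\<^bsub>H\<^esub> y)"
proof (rule vec_tendstoI)
  fix n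
  have "s n \<oplus>\<^bsub>H\<^esub> r n \<ominus>\<^bsub>H\<^esub> (x \<oplus>\<^bsub>H\<^esub> y) = (s n \<ominus>\<^bsub>H\<^esub> x) \<oplus>\<^bsub>H\<^esub> (r n \<ominus>\<^bsub>H\<^esub> y)"
    using assms by (intro vec_eqI) (simp_all add: cinner_simps)
  then show "hnorm H (s n \<oplus>\<^bsub>H\<^esub> r n \<ominus>\<^bsub>H\<^esub> (x \<oplus>\<^bsub>H\<^esub> y)) \<le> hnorm H (s n \<ominus>\<^bsub>H\<^esub> x) + hnorm H (r n \<ominus>\<^bsub>H\<^esub> y)"
    using assms by (simp add: hnorm_add_le)
next
  show "(\<lambda>n. hnorm H (s n \<ominus>\<^bsub>H\<^esub> x) + hnorm H (r n \<ominus>\<^bsub>H\<^esub> y)) \<longlonglongrightarrow> 0"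
    using tendsto_add[OF lim[unfolded vec_tendsto_def]] by simp
qed (use assms in simp_all)

lemma vec_tendsto_smult:
  assumes "\<And>n. s n \<in> carrier H" "x \<in> carrier H" and lim: "vec_tendsto s x"
  shows "vec_tendsto (\<lambda>n. c \<odot>\<^bsub>H\<^esub> s n) (c \<odot>\<^bsub>H\<^esub> x)"
proof (rule vec_tendstoI)
  fix n
  have "c \<odot>\<^bsub>H\<^esub> s n \<ominus>\<^bsub>H\<^esub> c \<odot>\<^bsub>H\<^esub> x = c \<odot>\<^bsub>H\<^esub> (s n \<ominus>\<^bsub>H\<^esub> x)"
    using assms by (intro vec_eqI) (simp_all add: cinner_simps algebra_simps)
  then show "hnorm H (c \<odot>\<^bsub>H\<^esub> s n \<ominus>\<^bsub>H\<^esub> c \<odot>\<^bsub>H\<^esub> x) \<le> cmod c * hnorm H (s n \<ominus>\<^bsub>H\<^esub> x)"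
    using assms by (simp add: hnorm_smult)
next
  show "(\<lambda>n. cmod c * hnorm H (s n \<ominus>\<^bsub>H\<^esub> x)) \<longlonglongrightarrow> 0"
    using tendsto_mult_left[OF lim[unfolded vec_tendsto_def], of "cmod c"] by simp
qed (use assms in simp_all)

lemma vec_tendsto_cinner:
  assumes "\<And>n. s n \<in> carrier H" "x \<in> carrier H" "y \<in> carrier H" and lim: "vec_tendsto s x"
  shows "(\<lambda>n. cinner H (s n) y) \<longlonglongrightarrow> cinner H x y"
proof (rule Lim_null_comparison[THEN LIM_zero_cancel])
  show "\<forall>\<^sub>F n in sequentially. norm (cinner H (s n) y - cinner H x y) \<le> hnorm H (s n \<ominus>\<^bsub>H\<^esub> x) * hnorm H y"
    using assms Cauchy_Schwarz[OF M.minus_closed[OF assms(1,2)] assms(3)]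
    by (intro always_eventually allI) (simp add: cinner_diff_left)
  show "(\<lambda>n. hnorm H (s n \<ominus>\<^bsub>H\<^esub> x) * hnorm H y) \<longlonglongrightarrow> 0"
    using tendsto_mult_right[OF lim[unfolded vec_tendsto_def], of "hnorm H y"] by simp
qed

lemma hnorm_le_op_norm:
  assumes T: "bounded_op H T" and x: "x \<in> carrier H"
  shows "hnorm H (T x) \<le> op_norm H T * hnorm H x"
proof (cases "hnorm H x = 0")
  case True
  obtain K where "hnorm H (T x) \<le> K * hnorm H x"
    using T x unfolding bounded_op_def by blast
  then show ?thesis
    using True by simp
next
  case False
  then have pos: "hnorm H x > 0"
    using hnorm_ge_0[OF x] by linarith
  obtain K where K: "K > 0" "\<And>x. x \<in> carrier H \<Longrightarrow> hnorm H (T x) \<le> K * hnorm H x"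
    using T by (rule bounded_op_bound) blast
  have bdd: "bdd_above ((\<lambda>x. hnorm H (T x)) ` {x \<in> carrier H. hnorm H x \<le> 1})"
  proof (rule bdd_aboveI2)
    fix y assume "y \<in> {x \<in> carrier H. hnorm H x \<le> 1}"
    then have y: "y \<in> carrier H" "hnorm H y \<le> 1"
      by auto
    have "K * hnorm H y \<le> K * 1"
      using y(2) K(1) by (intro mult_left_mono) auto
    then show "hnorm H (T y) \<le> K"
      using K(2)[OF y(1)] by linarith
  qed
  let ?c = "complex_of_real (1 / hnorm H x)"
  have cx: "hnorm H (?c \<odot>\<^bsub>H\<^esub> x) = 1"
    using x pos by (simp add: hnorm_smult norm_divide)
  have "hnorm H (T (?c \<odot>\<^bsub>H\<^esub> x)) \<le> op_norm H T"
    unfolding op_norm_def using x cx by (intro cSUP_upper[OF _ bdd]) simp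
  moreover have "hnorm H (T (?c \<odot>\<^bsub>H\<^esub> x)) = hnorm H (T x) / hnorm H x"
    using x pos by (simp add: bounded_op_smult[OF T] hnorm_smult bounded_op_closed[OF T] norm_divide)
  ultimately show ?thesis
    using pos by (simp add: divide_le_eq)
qed

lemma op_norm_le:
  assumes c: "c \<ge> 0" and "\<And>x. x \<in> carrier H \<Longrightarrow> hnorm H (T x) \<le> c * hnorm H x"
  shows "op_norm H T \<le> c"
  unfolding op_norm_def
proof (rule cSUP_least)
  show "{x \<in> carrier H. hnorm H x \<le> 1} \<noteq> {}"
    using M.zero_closed hnorm_zero by (metis (mono_tags, lifting) empty_iff mem_Collect_eq zero_le_one)
  fix x assume "x \<in> {x \<in> carrier H. hnorm H x \<le> 1}"
  then have x: "x \<in> carrier H" "hnorm H x \<le> 1"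
    by auto
  have "c * hnorm H x \<le> c * 1"
    using x(2) c by (rule mult_left_mono)
  then show "hnorm H (T x) \<le> c"
    using assms(2)[OF x(1)] by linarith
qed

lemma op_norm_ge_0:
  assumes T: "bounded_op H T"
  shows "0 \<le> op_norm H T"
proof -
  obtain x where x: "x \<in> carrier H" "hnorm H x > 0"
    by (rule ex_nonzero)
  have "0 \<le> op_norm H T * hnorm H x"
    using hnorm_ge_0[OF bounded_op_closed[OF T x(1)]] hnorm_le_op_norm[OF T x(1)] by linarith
  then show ?thesis
    using x(2) by (simp add: zero_le_mult_iff)
qed

lemma poly_op_diff_le:
  assumes A: "self_adjoint_op H A"
    and pq: "\<And>t. t \<in> real_spectrum A \<Longrightarrow> \<bar>poly p t - poly q t\<bar> \<le> c"
    and x: "x \<in> carrier H"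
  shows "hnorm H (poly_op H p A x \<ominus>\<^bsub>H\<^esub> poly_op H q A x) \<le> c * hnorm H x"
  using hnorm_poly_op_le[OF A _ x, of "p - q" c] pq
  by (simp add: real_spectrum_def poly_op_diff[OF self_adjoint_bounded[OF A] x])

text \<open>
  The pointwise limit of \<open>p\<^sub>n(A)\<close> is within \<open>c\<close> of every \<open>q(A)\<close> for which \<open>q\<close> is within \<open>c\<close>
  of \<open>f\<close> on the spectrum; this makes it the limit of every approximating sequence.
\<close>

lemma ex_functional_calculus:
  assumes A: "self_adjoint_op H A"
    and p: "uniform_limit (real_spectrum A) (\<lambda>n. poly (p n)) f sequentially"
  obtains T where "bounded_op H T" "T \<in> extensional (carrier H)"
    "\<And>q c x. (\<And>t. t \<in> real_spectrum A \<Longrightarrow> \<bar>poly q t - f t\<bar> \<le> c) \<Longrightarrow> x \<in> carrier H \<Longrightarrow>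
       hnorm H (poly_op H q A x \<ominus>\<^bsub>H\<^esub> T x) \<le> c * hnorm H x"
proof -
  note bA = self_adjoint_bounded[OF A]
  note cl [simp] = poly_op_closed[OF bA]
  have unif: "\<exists>N. \<forall>n\<ge>N. \<forall>t\<in>real_spectrum A. \<bar>poly (p n) t - f t\<bar> < e" if "e > 0" for e
    using p that by (simp add: uniform_limit_sequentially_iff dist_real_def)
  have "\<exists>y\<in>carrier H. vec_tendsto (\<lambda>n. poly_op H (p n) A x) y" if x: "x \<in> carrier H" for x
    unfolding vec_tendsto_def
  proof (rule complete)
    fix e :: real assume "e > 0"
    \<comment> \<open>Two approximations within \<open>d\<close> of \<open>f\<close> differ by at most \<open>2 d \<parallel>x\<parallel> < e\<close> at \<open>x\<close>; the summand \<open>1\<close> covers \<open>x = 0\<close>.\<close>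
    define d where "d = e / (2 * (hnorm H x + 1))"
    have "d > 0"
      using \<open>e > 0\<close> hnorm_ge_0[OF x] unfolding d_def
      by (intro divide_pos_pos mult_pos_pos add_nonneg_pos) auto
    then obtain N where N: "\<And>n t. n \<ge> N \<Longrightarrow> t \<in> real_spectrum A \<Longrightarrow> \<bar>poly (p n) t - f t\<bar> < d"
      using unif by blast
    have "hnorm H (poly_op H (p i) A x \<ominus>\<^bsub>H\<^esub> poly_op H (p j) A x) < e" if ij: "i \<ge> N" "j \<ge> N" for i j
    proof -
      have "hnorm H (poly_op H (p i) A x \<ominus>\<^bsub>H\<^esub> poly_op H (p j) A x) \<le> (2 * d) * hnorm H x"
      proof (rule poly_op_diff_le[OF A _ x])
        fix t assume "t \<in> real_spectrum A"
        then show "\<bar>poly (p i) t - poly (p j) t\<bar> \<le> 2 * d"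
          using N[OF ij(1), of t] N[OF ij(2), of t] by linarith
      qed
      also have "\<dots> < (2 * d) * (hnorm H x + 1)"
        using \<open>d > 0\<close> by simp
      also have "\<dots> = e"
      proof -
        have "hnorm H x + 1 \<noteq> 0"
          using hnorm_ge_0[OF x] by linarith
        then show ?thesis
          by (simp add: d_def field_simps)
      qed
      finally show ?thesis .
    qed
    then show "\<exists>N. \<forall>i\<ge>N. \<forall>j\<ge>N. hnorm H (poly_op H (p i) A x \<ominus>\<^bsub>H\<^esub> poly_op H (p j) A x) < e"
      by blast
  qed (use x in simp)
  then obtain L where L: "\<And>x. x \<in> carrier H \<Longrightarrow> L x \<in> carrier H"
      "\<And>x. x \<in> carrier H \<Longrightarrow> vec_tendsto (\<lambda>n. poly_op H (p n) A x) (L x)"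
    by metis
  define T where "T = restrict L (carrier H)"
  have Tcl [simp]: "T x \<in> carrier H" and Tlim: "vec_tendsto (\<lambda>n. poly_op H (p n) A x) (T x)"
    if "x \<in> carrier H" for x
    using that L by (simp_all add: T_def)
  have est: "hnorm H (poly_op H q A x \<ominus>\<^bsub>H\<^esub> T x) \<le> c * hnorm H x"
    if q: "\<And>t. t \<in> real_spectrum A \<Longrightarrow> \<bar>poly q t - f t\<bar> \<le> c" and x: "x \<in> carrier H" for q c x
  proof -
    have "hnorm H (poly_op H q A x \<ominus>\<^bsub>H\<^esub> T x) \<le> (c + d) * hnorm H x" if "d > 0" for d
    proof -
      obtain N where N: "\<And>n t. n \<ge> N \<Longrightarrow> t \<in> real_spectrum A \<Longrightarrow> \<bar>poly (p n) t - f t\<bar> < d"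
        using unif[OF \<open>d > 0\<close>] by blast
      have "hnorm H (poly_op H q A x \<ominus>\<^bsub>H\<^esub> T x) \<le>
          (c + d) * hnorm H x + hnorm H (poly_op H (p n) A x \<ominus>\<^bsub>H\<^esub> T x)" if "n \<ge> N" for n
      proof -
        have "hnorm H (poly_op H q A x \<ominus>\<^bsub>H\<^esub> poly_op H (p n) A x) \<le> (c + d) * hnorm H x"
        proof (rule poly_op_diff_le[OF A _ x])
          fix t assume "t \<in> real_spectrum A"
          then show "\<bar>poly q t - poly (p n) t\<bar> \<le> c + d"
            using N[OF \<open>n \<ge> N\<close>, of t] q[of t] by linarith
        qed
        then show ?thesis
          using hnorm_triangle[of "poly_op H q A x" "poly_op H (p n) A x" "T x"] x by simp
      qed
      moreover have "(\<lambda>n. (c + d) * hnorm H x + hnorm H (poly_op H (p n) A x \<ominus>\<^bsub>H\<^esub> T x))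
          \<longlonglongrightarrow> (c + d) * hnorm H x + 0"
        using Tlim[OF x] unfolding vec_tendsto_def by (intro tendsto_intros)
      ultimately have "hnorm H (poly_op H q A x \<ominus>\<^bsub>H\<^esub> T x) \<le> (c + d) * hnorm H x + 0"
        by (intro LIMSEQ_le_const) blast+
      then show ?thesis
        by simp
    qed
    then have bound: "hnorm H (poly_op H q A x \<ominus>\<^bsub>H\<^esub> T x) \<le> c * hnorm H x + d * hnorm H x" if "d > 0" for d
      using that by (simp add: distrib_right)
    show ?thesis
    proof (rule field_le_epsilon)
      fix e :: real assume "e > 0"
      define d where "d = e / (hnorm H x + 1)"
      have nx: "hnorm H x + 1 > 0"
        using hnorm_ge_0[OF x] by linarith
      then have "d > 0"
        using \<open>e > 0\<close> by (simp add: d_def)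
      then have "d * hnorm H x \<le> d * (hnorm H x + 1)"
        by (intro mult_left_mono) auto
      also have "\<dots> = e"
        using nx by (simp add: d_def)
      finally show "hnorm H (poly_op H q A x \<ominus>\<^bsub>H\<^esub> T x) \<le> c * hnorm H x + e"
        using bound[OF \<open>d > 0\<close>] by linarith
    qed
  qed
  have "bounded_op H T"
    unfolding bounded_op_def
  proof (intro conjI ballI allI)
    show "T \<in> carrier H \<rightarrow> carrier H"
      by simp
  next
    fix x y assume x: "x \<in> carrier H" and y: "y \<in> carrier H"
    have "vec_tendsto (\<lambda>n. poly_op H (p n) A x \<oplus>\<^bsub>H\<^esub> poly_op H (p n) A y) (T x \<oplus>\<^bsub>H\<^esub> T y)"
      using x y by (intro vec_tendsto_add Tlim) simp_all
    moreover have "poly_op H (p n) A x \<oplus>\<^bsub>H\<^esub> poly_op H (p n) A y = poly_op H (p n) A (x \<oplus>\<^bsub>H\<^esub> y)" for n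
      using bounded_op_add[OF bounded_op_poly_op[OF bA] x y] by simp
    ultimately have "vec_tendsto (\<lambda>n. poly_op H (p n) A (x \<oplus>\<^bsub>H\<^esub> y)) (T x \<oplus>\<^bsub>H\<^esub> T y)"
      by simp
    then show "T (x \<oplus>\<^bsub>H\<^esub> y) = T x \<oplus>\<^bsub>H\<^esub> T y"
      using x y by (intro vec_tendsto_unique[OF _ _ _ Tlim]) simp_all
  next
    fix c x assume x: "x \<in> carrier H"
    have "vec_tendsto (\<lambda>n. c \<odot>\<^bsub>H\<^esub> poly_op H (p n) A x) (c \<odot>\<^bsub>H\<^esub> T x)"
      using x by (intro vec_tendsto_smult Tlim) simp_all
    then have "vec_tendsto (\<lambda>n. poly_op H (p n) A (c \<odot>\<^bsub>H\<^esub> x)) (c \<odot>\<^bsub>H\<^esub> T x)"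
      using bounded_op_smult[OF bounded_op_poly_op[OF bA] x] by simp
    then show "T (c \<odot>\<^bsub>H\<^esub> x) = c \<odot>\<^bsub>H\<^esub> T x"
      using x by (intro vec_tendsto_unique[OF _ _ _ Tlim]) simp_all
  next
    obtain N where N: "\<forall>n\<ge>N. \<forall>t\<in>real_spectrum A. \<bar>poly (p n) t - f t\<bar> < 1"
      using unif[of 1] by auto
    obtain K where K: "K > 0" "\<And>x. x \<in> carrier H \<Longrightarrow> hnorm H (poly_op H (p N) A x) \<le> K * hnorm H x"
      using bounded_op_poly_op[OF bA] by (rule bounded_op_bound) blast
    have "hnorm H (T x) \<le> (K + 1) * hnorm H x" if x: "x \<in> carrier H" for x
    proof -
      have "hnorm H (poly_op H (p N) A x \<ominus>\<^bsub>H\<^esub> T x) \<le> 1 * hnorm H x"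
        using N x by (intro est) (auto intro: less_imp_le)
      moreover have "T x = poly_op H (p N) A x \<ominus>\<^bsub>H\<^esub> (poly_op H (p N) A x \<ominus>\<^bsub>H\<^esub> T x)"
        using x by (intro vec_eqI) (simp_all add: cinner_simps)
      ultimately show ?thesis
        using K(2)[OF x] hnorm_diff_le[of "poly_op H (p N) A x" "poly_op H (p N) A x \<ominus>\<^bsub>H\<^esub> T x"] x
        by (simp add: distrib_right)
    qed
    then show "\<exists>K. \<forall>x\<in>carrier H. hnorm H (T x) \<le> K * hnorm H x"
      by blast
  qed
  moreover have "T \<in> extensional (carrier H)"
    by (simp add: T_def)
  ultimately show ?thesis
    using that est by blast
qed

lemma op_norm_tendsto_imp_vec_tendsto:
  assumes A: "self_adjoint_op H A" and T: "bounded_op H T" and x: "x \<in> carrier H"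
    and lim: "(\<lambda>n. op_norm H (diff_op H (poly_op H (p n) A) T)) \<longlonglongrightarrow> 0"
  shows "vec_tendsto (\<lambda>n. poly_op H (p n) A x) (T x)"
proof (rule vec_tendstoI)
  note bA = self_adjoint_bounded[OF A]
  fix n
  show "poly_op H (p n) A x \<in> carrier H"
    using bA x by (rule poly_op_closed)
  show "hnorm H (poly_op H (p n) A x \<ominus>\<^bsub>H\<^esub> T x) \<le> op_norm H (diff_op H (poly_op H (p n) A) T) * hnorm H x"
    using hnorm_le_op_norm[OF bounded_op_diff_op[OF bounded_op_poly_op[OF bA] T] x]
    by (simp add: diff_op_def)
next
  show "T x \<in> carrier H"
    using T x by (rule bounded_op_closed)
  show "(\<lambda>n. op_norm H (diff_op H (poly_op H (p n) A) T) * hnorm H x) \<longlonglongrightarrow> 0"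
    using tendsto_mult_right[OF lim, of "hnorm H x"] by simp
qed

text \<open>
  A single approximating sequence secures both existence and uniqueness of the operator described by
  \<^const>\<open>fun_calc\<close>.
\<close>

lemma fun_calc:
  assumes A: "self_adjoint_op H A"
    and p: "uniform_limit (real_spectrum A) (\<lambda>n. poly (p n)) f sequentially"
  shows bounded_op_fun_calc: "bounded_op H (fun_calc H f A)"
    and poly_op_tendsto_fun_calc:
      "x \<in> carrier H \<Longrightarrow> vec_tendsto (\<lambda>n. poly_op H (p n) A x) (fun_calc H f A x)"
proof -
  note bA = self_adjoint_bounded[OF A]
  obtain T where T: "bounded_op H T" "T \<in> extensional (carrier H)"
    and est: "\<And>q c x. (\<And>t. t \<in> real_spectrum A \<Longrightarrow> \<bar>poly q t - f t\<bar> \<le> c) \<Longrightarrow> x \<in> carrier H \<Longrightarrow>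
       hnorm H (poly_op H q A x \<ominus>\<^bsub>H\<^esub> T x) \<le> c * hnorm H x"
    using A p by (rule ex_functional_calculus) blast
  define calc where "calc S \<longleftrightarrow> bounded_op H S \<and> S \<in> extensional (carrier H) \<and>
     (\<forall>p :: nat \<Rightarrow> real poly. uniform_limit (real_spectrum A) (\<lambda>n. poly (p n)) f sequentially
        \<longrightarrow> (\<lambda>n. op_norm H (diff_op H (poly_op H (p n) A) S)) \<longlonglongrightarrow> 0)" for S
  have "(\<lambda>n. op_norm H (diff_op H (poly_op H (q n) A) T)) \<longlonglongrightarrow> 0"
    if q: "uniform_limit (real_spectrum A) (\<lambda>n. poly (q n)) f sequentially" for q :: "nat \<Rightarrow> real poly"
  proof (rule LIMSEQ_I)
    fix e :: real assume "e > 0"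
    then obtain N where N: "\<And>n t. n \<ge> N \<Longrightarrow> t \<in> real_spectrum A \<Longrightarrow> \<bar>poly (q n) t - f t\<bar> < e / 2"
      using q[unfolded uniform_limit_sequentially_iff, rule_format, of "e / 2"]
      by (auto simp: dist_real_def)
    have "norm (op_norm H (diff_op H (poly_op H (q n) A) T) - 0) < e" if "n \<ge> N" for n
    proof -
      have "op_norm H (diff_op H (poly_op H (q n) A) T) \<le> e / 2"
      proof (rule op_norm_le)
        fix x assume x: "x \<in> carrier H"
        have "hnorm H (poly_op H (q n) A x \<ominus>\<^bsub>H\<^esub> T x) \<le> e / 2 * hnorm H x"
          using N[OF that] x by (intro est less_imp_le)
        then show "hnorm H (diff_op H (poly_op H (q n) A) T x) \<le> e / 2 * hnorm H x"
          by (simp only: diff_op_def)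
      qed (use \<open>e > 0\<close> in simp)
      moreover have "0 \<le> op_norm H (diff_op H (poly_op H (q n) A) T)"
        by (intro op_norm_ge_0 bounded_op_diff_op bounded_op_poly_op bA T)
      ultimately show ?thesis
        using \<open>e > 0\<close> by simp
    qed
    then show "\<exists>N. \<forall>n\<ge>N. norm (op_norm H (diff_op H (poly_op H (q n) A) T) - 0) < e"
      by blast
  qed
  then have "calc T"
    using T unfolding calc_def by blast
  moreover have "S = T" if "calc S" for S
  proof (rule extensionalityI)
    fix x assume x: "x \<in> carrier H"
    show "S x = T x"
    proof (rule vec_tendsto_unique)
      show "vec_tendsto (\<lambda>n. poly_op H (p n) A x) (S x)" "vec_tendsto (\<lambda>n. poly_op H (p n) A x) (T x)"
        using \<open>calc S\<close> \<open>calc T\<close> p x unfolding calc_def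
        by (blast intro: op_norm_tendsto_imp_vec_tendsto[OF A])+
      show "S x \<in> carrier H" "T x \<in> carrier H" "\<And>n. poly_op H (p n) A x \<in> carrier H"
        using \<open>calc S\<close> T(1) bA x unfolding calc_def by (blast intro: bounded_op_closed poly_op_closed)+
    qed
  qed (use T \<open>calc S\<close> in \<open>auto simp: calc_def\<close>)
  ultimately have "(THE S. calc S) = T"
    by (rule the_equality)
  then have "fun_calc H f A = T"
    by (simp add: fun_calc_def calc_def real_spectrum_def)
  then show "bounded_op H (fun_calc H f A)"
    and "x \<in> carrier H \<Longrightarrow> vec_tendsto (\<lambda>n. poly_op H (p n) A x) (fun_calc H f A x)"
    using T(1) \<open>calc T\<close> p op_norm_tendsto_imp_vec_tendsto[OF A T(1)] unfolding calc_def by blast+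
qed

lemma poly_op_form_tendsto:
  assumes A: "self_adjoint_op H A"
    and p: "uniform_limit (real_spectrum A) (\<lambda>n. poly (p n)) f sequentially"
    and x: "x \<in> carrier H"
  shows "(\<lambda>n. cinner H (poly_op H (p n) A x) x) \<longlonglongrightarrow> cinner H (fun_calc H f A x) x"
  using x bounded_op_closed[OF bounded_op_fun_calc[OF A p] x] poly_op_closed[OF self_adjoint_bounded[OF A] x]
  by (intro vec_tendsto_cinner poly_op_tendsto_fun_calc[OF A p]) auto

lemma Im_fun_calc_form:
  assumes A: "self_adjoint_op H A"
    and p: "uniform_limit (real_spectrum A) (\<lambda>n. poly (p n)) f sequentially"
    and x: "x \<in> carrier H"
  shows "Im (cinner H (fun_calc H f A x) x) = 0"
proof -
  have "Im (cinner H (poly_op H (p n) A x) x) = 0" for n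
    using self_adjoint_form[OF self_adjoint_poly_op[OF A] x] by (metis Im_complex_of_real)
  then have "(\<lambda>n. 0) \<longlonglongrightarrow> Im (cinner H (fun_calc H f A x) x)"
    using tendsto_Im[OF poly_op_form_tendsto[OF A p x]] by simp
  then show ?thesis
    using LIMSEQ_const_iff by metis
qed

lemma poly_op_eigenvector:
  assumes A: "bounded_op H A" and u: "u \<in> carrier H" "A u = complex_of_real t \<odot>\<^bsub>H\<^esub> u"
  shows "poly_op H p A u = complex_of_real (poly p t) \<odot>\<^bsub>H\<^esub> u"
proof (induction p)
  case 0
  then show ?case
    using u by (simp add: poly_op_0 smult_zero_left)
next
  case (pCons c p)
  then show ?case
    using u by (intro vec_eqI)
      (simp_all add: A poly_op_pCons bounded_op_smult[OF A] cinner_simps algebra_simps)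
qed

lemma fun_calc_eigenvector:
  assumes A: "self_adjoint_op H A"
    and p: "uniform_limit (real_spectrum A) (\<lambda>n. poly (p n)) f sequentially"
    and u: "u \<in> carrier H" "hnorm H u > 0" "A u = complex_of_real t \<odot>\<^bsub>H\<^esub> u"
  shows "fun_calc H f A u = complex_of_real (f t) \<odot>\<^bsub>H\<^esub> u"
proof -
  note bA = self_adjoint_bounded[OF A]
  have "approximate_kernel (\<lambda>x. A x \<ominus>\<^bsub>H\<^esub> complex_of_real t \<odot>\<^bsub>H\<^esub> x)"
    unfolding approximate_kernel_def using u by (intro allI impI bexI[of _ u]) simp_all
  then have "t \<in> real_spectrum A"
    unfolding real_spectrum_def using approximate_kernel_imp_spectrum[OF _ bA] by blast
  then have "(\<lambda>n. poly (p n) t) \<longlonglongrightarrow> f t"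
    using p by (rule tendsto_uniform_limitI[rotated])
  then have lim: "(\<lambda>n. \<bar>poly (p n) t - f t\<bar> * hnorm H u) \<longlonglongrightarrow> 0"
    using tendsto_mult_right[OF tendsto_rabs[OF LIM_zero], of _ "f t" _ "hnorm H u"] by simp
  show ?thesis
  proof (rule vec_tendsto_unique)
    show "vec_tendsto (\<lambda>n. poly_op H (p n) A u) (fun_calc H f A u)"
      using A p u(1) by (rule poly_op_tendsto_fun_calc)
    show "vec_tendsto (\<lambda>n. poly_op H (p n) A u) (complex_of_real (f t) \<odot>\<^bsub>H\<^esub> u)"
    proof (rule vec_tendstoI[OF _ _ _ lim])
      fix n
      have "poly_op H (p n) A u \<ominus>\<^bsub>H\<^esub> complex_of_real (f t) \<odot>\<^bsub>H\<^esub> u = complex_of_real (poly (p n) t - f t) \<odot>\<^bsub>H\<^esub> u"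
        using u by (intro vec_eqI) (simp_all add: poly_op_eigenvector[OF bA u(1,3)] cinner_simps algebra_simps)
      then show "hnorm H (poly_op H (p n) A u \<ominus>\<^bsub>H\<^esub> complex_of_real (f t) \<odot>\<^bsub>H\<^esub> u) \<le> \<bar>poly (p n) t - f t\<bar> * hnorm H u"
        using u(1) by (simp add: hnorm_smult del: of_real_diff)
    qed (use u poly_op_closed[OF bA] in auto)
  qed (use u poly_op_closed[OF bA] bounded_op_closed[OF bounded_op_fun_calc[OF A p]] in auto)
qed

lemma self_adjoint_shift:
  "self_adjoint_op H B \<Longrightarrow> self_adjoint_op H (\<lambda>x. B x \<oplus>\<^bsub>H\<^esub> complex_of_real m \<odot>\<^bsub>H\<^esub> x)"
  using self_adjoint_ident by (rule self_adjoint_lincomb[rotated])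

lemma spectrum_op_shift:
  assumes B: "self_adjoint_op H B"
  shows "z \<in> spectrum_op H (\<lambda>x. B x \<oplus>\<^bsub>H\<^esub> complex_of_real m \<odot>\<^bsub>H\<^esub> x) \<longleftrightarrow> z - complex_of_real m \<in> spectrum_op H B"
proof -
  note cl = self_adjoint_closed[OF B]
  have eq: "diff_op H (\<lambda>x. B x \<oplus>\<^bsub>H\<^esub> complex_of_real m \<odot>\<^bsub>H\<^esub> x) (scalar_op H z) x =
      diff_op H B (scalar_op H (z - complex_of_real m)) x" if "x \<in> carrier H" for x
    unfolding diff_op_def scalar_op_def using that cl
    by (intro vec_eqI) (simp_all add: cinner_simps algebra_simps)
  have iff: "(bounded_op H R \<and> (\<forall>x\<in>carrier H.
          R (diff_op H (\<lambda>x. B x \<oplus>\<^bsub>H\<^esub> complex_of_real m \<odot>\<^bsub>H\<^esub> x) (scalar_op H z) x) = x \<and>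
          diff_op H (\<lambda>x. B x \<oplus>\<^bsub>H\<^esub> complex_of_real m \<odot>\<^bsub>H\<^esub> x) (scalar_op H z) (R x) = x)) \<longleftrightarrow>
        (bounded_op H R \<and> (\<forall>x\<in>carrier H.
          R (diff_op H B (scalar_op H (z - complex_of_real m)) x) = x \<and>
          diff_op H B (scalar_op H (z - complex_of_real m)) (R x) = x))" for R
    using eq bounded_op_closed[of R] by (intro conj_cong ball_cong refl) auto
  show ?thesis
    by (simp only: spectrum_op_def mem_Collect_eq iff)
qed

lemma poly_op_shift:
  assumes B: "self_adjoint_op H B" and x: "x \<in> carrier H"
  shows "poly_op H p (\<lambda>x. B x \<oplus>\<^bsub>H\<^esub> complex_of_real m \<odot>\<^bsub>H\<^esub> x) x = poly_op H (pcompose p [:m, 1:]) B x"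
proof (induction p)
  case 0
  then show ?case
    using x by (simp add: poly_op_0)
next
  case (pCons c p)
  note bB = self_adjoint_bounded[OF B]
  let ?y = "poly_op H (pcompose p [:m, 1:]) B x"
  have y: "?y \<in> carrier H"
    using bB x by (rule poly_op_closed)
  have "poly_op H [:m, 1:] B ?y = complex_of_real m \<odot>\<^bsub>H\<^esub> ?y \<oplus>\<^bsub>H\<^esub> B ?y"
    by (simp only: poly_op_pCons[OF bB y, of m] poly_op_const[OF bB y] of_real_1 smult_one_left[OF y])
  then have "poly_op H (pcompose (pCons c p) [:m, 1:]) B x =
      complex_of_real c \<odot>\<^bsub>H\<^esub> x \<oplus>\<^bsub>H\<^esub> (complex_of_real m \<odot>\<^bsub>H\<^esub> ?y \<oplus>\<^bsub>H\<^esub> B ?y)"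
    by (simp only: pcompose_pCons poly_op_add[OF bB x] poly_op_mult[OF bB x] poly_op_const[OF bB x])
  also have "complex_of_real m \<odot>\<^bsub>H\<^esub> ?y \<oplus>\<^bsub>H\<^esub> B ?y = B ?y \<oplus>\<^bsub>H\<^esub> complex_of_real m \<odot>\<^bsub>H\<^esub> ?y"
    by (intro M.a_comm smult_in y bounded_op_closed[OF bB])
  finally show ?case
    by (simp only: pCons.IH poly_op_pCons[OF self_adjoint_bounded[OF self_adjoint_shift[OF B]] x])
qed

text \<open>
  For polynomials \<open>p\<close>, \<open>p(B + m) - p(B)\<close> is again a polynomial of \<open>B\<close>, bounded below through its values on the
  spectrum; the general case follows by approximating \<open>f\<close> uniformly on an interval that contains the spectra of
  both \<open>B\<close> and \<open>B + m\<close>.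
\<close>

lemma fun_calc_shift_diff_ge:
  fixes f :: "real \<Rightarrow> real"
  assumes B: "self_adjoint_op H B" and f: "continuous_on {l..u + m} f" and "m \<ge> 0"
    and spec: "real_spectrum B \<subseteq> {l..u}"
    and c: "\<And>t. t \<in> real_spectrum B \<Longrightarrow> c \<le> f (t + m) - f t"
    and x: "x \<in> carrier H"
  shows "c * (hnorm H x)\<^sup>2 \<le>
    Re (cinner H (fun_calc H f (\<lambda>x. B x \<oplus>\<^bsub>H\<^esub> complex_of_real m \<odot>\<^bsub>H\<^esub> x) x) x) - Re (cinner H (fun_calc H f B x) x)"
proof -
  let ?C = "\<lambda>x. B x \<oplus>\<^bsub>H\<^esub> complex_of_real m \<odot>\<^bsub>H\<^esub> x"
  note bB = self_adjoint_bounded[OF B]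
  note saC = self_adjoint_shift[OF B, of m]
  obtain p where p: "uniform_limit {l..u + m} (\<lambda>n. poly (p n)) f sequentially"
    using f by (rule Weierstrass_polys)
  have specC: "real_spectrum ?C \<subseteq> {l..u + m}"
  proof
    fix t assume "t \<in> real_spectrum ?C"
    then have "t - m \<in> real_spectrum B"
      using spectrum_op_shift[OF B] by (simp add: real_spectrum_def)
    then show "t \<in> {l..u + m}"
      using spec \<open>m \<ge> 0\<close> by force
  qed
  have pB: "uniform_limit (real_spectrum B) (\<lambda>n. poly (p n)) f sequentially"
    using p by (rule uniform_limit_on_subset) (use spec \<open>m \<ge> 0\<close> in force)
  have pC: "uniform_limit (real_spectrum ?C) (\<lambda>n. poly (p n)) f sequentially"
    using p specC by (rule uniform_limit_on_subset)
  let ?F = "\<lambda>n. Re (cinner H (poly_op H (p n) ?C x) x) - Re (cinner H (poly_op H (p n) B x) x)"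
  have lim: "?F \<longlonglongrightarrow> Re (cinner H (fun_calc H f ?C x) x) - Re (cinner H (fun_calc H f B x) x)"
    by (intro tendsto_diff tendsto_Re poly_op_form_tendsto saC pC B pB x)
  have low: "(c - 2 * d) * (hnorm H x)\<^sup>2 \<le>
      Re (cinner H (fun_calc H f ?C x) x) - Re (cinner H (fun_calc H f B x) x)" if "d > 0" for d
  proof -
    obtain N where N: "\<And>n t. n \<ge> N \<Longrightarrow> t \<in> {l..u + m} \<Longrightarrow> \<bar>poly (p n) t - f t\<bar> < d"
      using p[unfolded uniform_limit_sequentially_iff, rule_format, OF \<open>d > 0\<close>]
      unfolding dist_real_def by blast
    have "(c - 2 * d) * (hnorm H x)\<^sup>2 \<le> ?F n" if n: "n \<ge> N" for n
    proof -
      have "(c - 2 * d) * (hnorm H x)\<^sup>2 \<le>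
          Re (cinner H (poly_op H (pcompose (p n) [:m, 1:] - p n) B x) x)"
      proof (rule poly_op_form_ge[OF B _ x])
        fix t assume "complex_of_real t \<in> spectrum_op H B"
        then have t: "t \<in> real_spectrum B"
          by (simp add: real_spectrum_def)
        then have "t \<in> {l..u + m}" "t + m \<in> {l..u + m}"
          using spec \<open>m \<ge> 0\<close> by force+
        then show "c - 2 * d \<le> poly (pcompose (p n) [:m, 1:] - p n) t"
          using N[OF n, of t] N[OF n, of "t + m"] c[OF t] by (simp add: poly_pcompose add.commute)
      qed
      also have "\<dots> = ?F n"
        using x poly_op_closed[OF bB x]
        by (simp add: poly_op_diff[OF bB x] poly_op_shift[OF B x] cinner_diff_left)
      finally show ?thesis .
    qed
    then show ?thesis
      using LIMSEQ_le_const[OF lim] by blast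
  qed
  show ?thesis
  proof (rule field_le_epsilon)
    fix e :: real assume "e > 0"
    define d where "d = e / (2 * ((hnorm H x)\<^sup>2 + 1))"
    have pos: "(hnorm H x)\<^sup>2 + 1 > 0"
      by (intro add_nonneg_pos) auto
    then have "d > 0"
      using \<open>e > 0\<close> by (simp add: d_def)
    then have "2 * d * (hnorm H x)\<^sup>2 \<le> 2 * d * ((hnorm H x)\<^sup>2 + 1)"
      by (intro mult_left_mono) auto
    also have "\<dots> = e"
      using pos by (simp add: d_def field_simps)
    finally show "c * (hnorm H x)\<^sup>2 \<le>
        Re (cinner H (fun_calc H f ?C x) x) - Re (cinner H (fun_calc H f B x) x) + e"
      using low[OF \<open>d > 0\<close>] by (simp add: left_diff_distrib)
  qed
qed

end

section \<open>Symmetric operators on a complex plane\<close>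

text \<open>
  The Hilbert space \<open>\<complex>\<^sup>2\<close> carried over to the range of an injection \<open>\<phi>\<close>; operator monotonicity speaks only of
  Hilbert spaces whose vectors belong to the given type.
\<close>

definition plane_space :: "(complex \<times> complex \<Rightarrow> 'v) \<Rightarrow> 'v hilbert" where
  "plane_space \<phi> = \<lparr>carrier = range \<phi>, mult = undefined, one = undefined, zero = \<phi> 0,
     add = (\<lambda>u v. \<phi> (inv_into UNIV \<phi> u + inv_into UNIV \<phi> v)),
     smult = (\<lambda>c v. \<phi> (c * fst (inv_into UNIV \<phi> v), c * snd (inv_into UNIV \<phi> v))),
     cinner = (\<lambda>u v. fst (inv_into UNIV \<phi> u) * cnj (fst (inv_into UNIV \<phi> v)) + snd (inv_into UNIV \<phi> u) * cnj (snd (inv_into UNIV \<phi> v)))\<rparr>"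

text \<open>
  For \<open>p\<^sup>2 + q\<^sup>2 = 1\<close>, the operator with eigenvalues \<open>x\<close> and \<open>y\<close> on the orthonormal vectors \<open>(p, q)\<close> and
  \<open>(q, -p)\<close>; the numbers \<open>c\<close> and \<open>d\<close> are \<open>x\<close> and \<open>y\<close> times the coordinates of the argument in that basis. Complex
  eigenvalues are admitted so that resolvents have the same shape.
\<close>

definition plane_op ::
    "(complex \<times> complex \<Rightarrow> 'v) \<Rightarrow> real \<Rightarrow> real \<Rightarrow> complex \<Rightarrow> complex \<Rightarrow> 'v \<Rightarrow> 'v" where
  "plane_op \<phi> p q x y v =
     (let a = fst (inv_into UNIV \<phi> v); b = snd (inv_into UNIV \<phi> v); c = x * (p * a + q * b); d = y * (q * a - p * b)
      in \<phi> (p * c + q * d, q * c - p * d))"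

context
  fixes \<phi> :: "complex \<times> complex \<Rightarrow> 'v"
  assumes inj: "inj \<phi>"
begin

lemma plane_simps [simp]:
  "carrier (plane_space \<phi>) = range \<phi>"
  "\<zero>\<^bsub>plane_space \<phi>\<^esub> = \<phi> 0"
  "\<phi> u \<oplus>\<^bsub>plane_space \<phi>\<^esub> \<phi> v = \<phi> (u + v)"
  "c \<odot>\<^bsub>plane_space \<phi>\<^esub> \<phi> u = \<phi> (c * fst u, c * snd u)"
  "cinner (plane_space \<phi>) (\<phi> u) (\<phi> v) = fst u * cnj (fst v) + snd u * cnj (snd v)"
  "plane_op \<phi> p q x y (\<phi> u) =
     \<phi> (p * (x * (p * fst u + q * snd u)) + q * (y * (q * fst u - p * snd u)),
        q * (x * (p * fst u + q * snd u)) - p * (y * (q * fst u - p * snd u)))"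
  by (simp_all add: plane_space_def plane_op_def inj Let_def)

lemma hnorm_plane: "hnorm (plane_space \<phi>) (\<phi> u) = norm u"
  by (simp add: hnorm_def norm_prod_def cmod_power2 flip: power2_eq_square)

lemma abelian_group_plane: "abelian_group (plane_space \<phi>)"
proof (rule abelian_groupI)
  fix x assume "x \<in> carrier (plane_space \<phi>)"
  then obtain u where "x = \<phi> u"
    by auto
  then have "\<phi> (- u) \<oplus>\<^bsub>plane_space \<phi>\<^esub> x = \<zero>\<^bsub>plane_space \<phi>\<^esub>"
    by simp
  then show "\<exists>y\<in>carrier (plane_space \<phi>). y \<oplus>\<^bsub>plane_space \<phi>\<^esub> x = \<zero>\<^bsub>plane_space \<phi>\<^esub>"
    using plane_simps(1) by blast
qed (auto simp: algebra_simps)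

lemma plane_diff [simp]: "\<phi> u \<ominus>\<^bsub>plane_space \<phi>\<^esub> \<phi> v = \<phi> (u - v)"
proof -
  interpret abelian_group "plane_space \<phi>"
    by (rule abelian_group_plane)
  have "\<ominus>\<^bsub>plane_space \<phi>\<^esub> \<phi> v = \<phi> (- v)"
    by (rule minus_equality) auto
  then show ?thesis
    by (simp add: a_minus_def)
qed

lemma complex_hilbert_space_plane: "complex_hilbert_space (plane_space \<phi>)"
proof (intro complex_hilbert_space.intro complex_hilbert_space_axioms.intro)
  show "Module.module (cring_class_ops :: complex ring) (plane_space \<phi>)"
    by (rule moduleI[OF cring_class abelian_group_plane])
      (auto simp: class_simps algebra_simps)
  have "\<phi> 0 \<noteq> \<phi> (1, 0)"
    using inj by (auto dest: injD simp: zero_prod_def)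
  then show "carrier (plane_space \<phi>) \<noteq> {\<zero>\<^bsub>plane_space \<phi>\<^esub>}"
    using rangeI[of \<phi> "(1, 0)"] by (metis plane_simps(1,2) singletonD)
next
  fix x assume x: "x \<in> carrier (plane_space \<phi>)" and "cinner (plane_space \<phi>) x x = 0"
  then have "hnorm (plane_space \<phi>) x = 0"
    by (simp add: hnorm_def)
  moreover obtain u where "x = \<phi> u"
    using x by auto
  ultimately show "x = \<zero>\<^bsub>plane_space \<phi>\<^esub>"
    by (simp add: hnorm_plane)
next
  fix s :: "nat \<Rightarrow> 'v" assume s: "\<And>n. s n \<in> carrier (plane_space \<phi>)"
    and Cau: "\<And>e. e > 0 \<Longrightarrow> \<exists>N. \<forall>i\<ge>N. \<forall>j\<ge>N. hnorm (plane_space \<phi>) (s i \<ominus>\<^bsub>plane_space \<phi>\<^esub> s j) < e"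
  have "\<forall>n. \<exists>u. s n = \<phi> u"
    using s by (metis plane_simps(1) rangeE)
  then obtain r where r: "\<And>n. s n = \<phi> (r n)"
    by metis
  have "Cauchy r"
    using Cau by (simp add: r hnorm_plane Cauchy_def dist_norm)
  then obtain w where "r \<longlonglongrightarrow> w"
    using Cauchy_convergent_iff convergent_def by blast
  then have "(\<lambda>n. hnorm (plane_space \<phi>) (s n \<ominus>\<^bsub>plane_space \<phi>\<^esub> \<phi> w)) \<longlonglongrightarrow> 0"
    by (simp add: r hnorm_plane tendsto_norm_zero_iff LIM_zero_iff)
  then show "\<exists>x\<in>carrier (plane_space \<phi>). (\<lambda>n. hnorm (plane_space \<phi>) (s n \<ominus>\<^bsub>plane_space \<phi>\<^esub> x)) \<longlonglongrightarrow> 0"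
    unfolding plane_simps(1) by blast
qed (auto simp: algebra_simps)

lemma bounded_op_plane_op: "bounded_op (plane_space \<phi>) (plane_op \<phi> p q x y)"
proof -
  define M :: "complex \<times> complex \<Rightarrow> complex \<times> complex" where
    "M u = (complex_of_real p * (x * (p * fst u + q * snd u)) + q * (y * (q * fst u - p * snd u)),
        complex_of_real q * (x * (p * fst u + q * snd u)) - p * (y * (q * fst u - p * snd u)))"
    for u :: "complex \<times> complex"
  have "linear M"
    by (rule linearI) (simp_all add: M_def algebra_simps scaleR_prod_def scaleR_conv_of_real)
  then obtain K where K: "\<And>u. norm (M u) \<le> K * norm u"
    using linear_bounded by blast
  have op: "plane_op \<phi> p q x y (\<phi> u) = \<phi> (M u)" for u
    by (simp add: M_def)
  show ?thesis
    unfolding bounded_op_def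
  proof (intro conjI exI[of _ K] ballI)
    fix v assume "v \<in> carrier (plane_space \<phi>)"
    then obtain u where "v = \<phi> u"
      by auto
    then show "hnorm (plane_space \<phi>) (plane_op \<phi> p q x y v) \<le> K * hnorm (plane_space \<phi>) v"
      using K by (simp only: op hnorm_plane)
  qed (auto simp: algebra_simps)
qed

lemma self_adjoint_plane_op:
  "self_adjoint_op (plane_space \<phi>) (plane_op \<phi> p q (complex_of_real x) (complex_of_real y))"
  unfolding self_adjoint_op_def by (auto simp: bounded_op_plane_op algebra_simps)

lemma plane_op_comp:
  assumes "p\<^sup>2 + q\<^sup>2 = 1"
  shows "plane_op \<phi> p q x y (plane_op \<phi> p q x' y' (\<phi> u)) = plane_op \<phi> p q (x * x') (y * y') (\<phi> u)"
proof -
  have pq: "complex_of_real p * complex_of_real p + complex_of_real q * complex_of_real q = 1"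
    using assms by (metis of_real_1 of_real_add of_real_mult power2_eq_square)
  have 1: "p * (p * c + q * d) + q * (q * c - p * d) = c" for c d :: complex
  proof -
    have "p * (p * c + q * d) + q * (q * c - p * d) = (complex_of_real p * complex_of_real p + complex_of_real q * complex_of_real q) * c"
      by (simp add: algebra_simps)
    then show ?thesis
      by (simp add: pq)
  qed
  have 2: "q * (p * c + q * d) - p * (q * c - p * d) = d" for c d :: complex
  proof -
    have "q * (p * c + q * d) - p * (q * c - p * d) = (complex_of_real p * complex_of_real p + complex_of_real q * complex_of_real q) * d"
      by (simp add: algebra_simps)
    then show ?thesis
      by (simp add: pq)
  qed
  show ?thesis
    by (simp add: 1 2 mult.assoc)
qed

lemma plane_op_one:
  assumes "p\<^sup>2 + q\<^sup>2 = 1"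
  shows "plane_op \<phi> p q 1 1 (\<phi> u) = \<phi> u"
proof -
  have pq: "complex_of_real p * complex_of_real p + complex_of_real q * complex_of_real q = 1"
    using assms by (metis of_real_1 of_real_add of_real_mult power2_eq_square)
  have "p * (p * fst u + q * snd u) + q * (q * fst u - p * snd u) =
      (complex_of_real p * complex_of_real p + complex_of_real q * complex_of_real q) * fst u"
    "q * (p * fst u + q * snd u) - p * (q * fst u - p * snd u) =
      (complex_of_real p * complex_of_real p + complex_of_real q * complex_of_real q) * snd u"
    by (simp_all add: algebra_simps)
  then show ?thesis
    by (simp add: pq)
qed

text \<open>
  Operators with the same eigenvectors multiply through their eigenvalues, so the resolvent at \<open>z\<close> has
  eigenvalues \<open>1 / (x - z)\<close> and \<open>1 / (y - z)\<close>.
\<close>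

lemma spectrum_plane_op:
  assumes pq: "p\<^sup>2 + q\<^sup>2 = 1"
  shows "spectrum_op (plane_space \<phi>) (plane_op \<phi> p q x y) \<subseteq> {x, y}"
proof
  fix z assume z: "z \<in> spectrum_op (plane_space \<phi>) (plane_op \<phi> p q x y)"
  show "z \<in> {x, y}"
  proof (rule ccontr)
    assume "z \<notin> {x, y}"
    then have nz: "x - z \<noteq> 0" "y - z \<noteq> 0"
      by auto
    let ?D = "diff_op (plane_space \<phi>) (plane_op \<phi> p q x y) (scalar_op (plane_space \<phi>) z)"
    let ?R = "plane_op \<phi> p q (1 / (x - z)) (1 / (y - z))"
    have D: "?D (\<phi> u) = plane_op \<phi> p q (x - z) (y - z) (\<phi> u)" for u
    proof -
      have "scalar_op (plane_space \<phi>) z (\<phi> u) = z \<odot>\<^bsub>plane_space \<phi>\<^esub> plane_op \<phi> p q 1 1 (\<phi> u)"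
        by (simp only: plane_op_one[OF pq] scalar_op_def)
      then show ?thesis
        by (simp add: diff_op_def algebra_simps)
    qed
    have R: "\<exists>w. ?R (\<phi> u) = \<phi> w" for u
      unfolding plane_simps by blast
    have "?R (?D v) = v \<and> ?D (?R v) = v" if "v \<in> carrier (plane_space \<phi>)" for v
    proof -
      obtain u where v: "v = \<phi> u"
        using \<open>v \<in> carrier (plane_space \<phi>)\<close> by auto
      obtain w where w: "?R (\<phi> u) = \<phi> w"
        using R by blast
      have "?D (?R v) = plane_op \<phi> p q (x - z) (y - z) (?R (\<phi> u))"
        unfolding v w D ..
      also have "\<dots> = v"
        using nz unfolding v plane_op_comp[OF pq] by (simp only: plane_op_one[OF pq] nonzero_mult_div_cancel_left times_divide_eq_right mult_1_right divide_self[OF nz(1)] divide_self[OF nz(2)])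
      finally have "?D (?R v) = v" .
      moreover have "?R (?D v) = v"
        using nz unfolding v D plane_op_comp[OF pq] by (simp only: plane_op_one[OF pq] times_divide_eq_left mult_1_left divide_self[OF nz(1)] divide_self[OF nz(2)])
      ultimately show ?thesis
        by blast
    qed
    then show False
      using z bounded_op_plane_op[of p q "1 / (x - z)" "1 / (y - z)"] unfolding spectrum_op_def by blast
  qed
qed

lemma plane_op_form:
  "cinner (plane_space \<phi>) (plane_op \<phi> p q (complex_of_real x) (complex_of_real y) (\<phi> (a, b))) (\<phi> (a, b)) =
    complex_of_real (x * (cmod (p * a + q * b))\<^sup>2 + y * (cmod (q * a - p * b))\<^sup>2)"
  unfolding of_real_add of_real_mult complex_norm_square by (simp add: algebra_simps)

text \<open>
  Both sides agree on the two eigenvectors, and these span the plane.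
\<close>

lemma fun_calc_plane_op:
  fixes f :: "real \<Rightarrow> real"
  assumes pq: "p\<^sup>2 + q\<^sup>2 = 1" and f: "continuous_on {min x y..max x y} f"
  shows "fun_calc (plane_space \<phi>) f (plane_op \<phi> p q (complex_of_real x) (complex_of_real y)) (\<phi> u) =
    plane_op \<phi> p q (complex_of_real (f x)) (complex_of_real (f y)) (\<phi> u)"
proof -
  interpret P: complex_hilbert_space "plane_space \<phi>"
    by (rule complex_hilbert_space_plane)
  let ?T = "plane_op \<phi> p q (complex_of_real x) (complex_of_real y)"
  let ?F = "fun_calc (plane_space \<phi>) f ?T"
  note T = self_adjoint_plane_op[of p q x y]
  obtain r where r: "uniform_limit {min x y..max x y} (\<lambda>n. poly (r n)) f sequentially"
    using f by (rule Weierstrass_polys)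
  have "P.real_spectrum ?T \<subseteq> {min x y..max x y}"
    using spectrum_plane_op[OF pq, of "complex_of_real x" "complex_of_real y"]
    by (force simp: P.real_spectrum_def)
  with r have lim: "uniform_limit (P.real_spectrum ?T) (\<lambda>n. poly (r n)) f sequentially"
    by (rule uniform_limit_on_subset)
  note bF = P.bounded_op_fun_calc[OF T lim]
  have pq': "complex_of_real p * complex_of_real p + complex_of_real q * complex_of_real q = 1"
    using pq by (metis of_real_1 of_real_add of_real_mult power2_eq_square)
  let ?u = "\<phi> (complex_of_real p, complex_of_real q)"
    and ?v = "\<phi> (complex_of_real q, - complex_of_real p)"
  have nz: "hnorm (plane_space \<phi>) ?u > 0" "hnorm (plane_space \<phi>) ?v > 0"
    using pq by (auto simp: hnorm_plane zero_prod_def)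
  have "?F ?u = complex_of_real (f x) \<odot>\<^bsub>plane_space \<phi>\<^esub> ?u"
    by (rule P.fun_calc_eigenvector[OF T lim _ nz(1)]) (auto simp: pq' mult.commute)
  moreover have "?F ?v = complex_of_real (f y) \<odot>\<^bsub>plane_space \<phi>\<^esub> ?v"
    by (rule P.fun_calc_eigenvector[OF T lim _ nz(2)]) (auto simp: pq' mult.commute add.commute)
  moreover have "\<phi> u = (p * fst u + q * snd u) \<odot>\<^bsub>plane_space \<phi>\<^esub> ?u
      \<oplus>\<^bsub>plane_space \<phi>\<^esub> (q * fst u - p * snd u) \<odot>\<^bsub>plane_space \<phi>\<^esub> ?v"
    using plane_op_one[OF pq, of u] by (simp add: mult.commute)
  ultimately have "?F (\<phi> u) = (p * fst u + q * snd u) \<odot>\<^bsub>plane_space \<phi>\<^esub> (complex_of_real (f x) \<odot>\<^bsub>plane_space \<phi>\<^esub> ?u)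
      \<oplus>\<^bsub>plane_space \<phi>\<^esub> (q * fst u - p * snd u) \<odot>\<^bsub>plane_space \<phi>\<^esub> (complex_of_real (f y) \<odot>\<^bsub>plane_space \<phi>\<^esub> ?v)"
    using P.bounded_op_add[OF bF] P.bounded_op_smult[OF bF] by (metis P.smult_in plane_simps(1) rangeI)
  then show ?thesis
    by (simp add: mult_ac)
qed

end

section \<open>Operator monotone functions on a half-line\<close>

text \<open>
  With \<open>k = (x - y) p q\<close> the off-diagonal entry, the difference of the two forms is at least
  \<open>\<alpha> a\<^sup>2 - 2 k a b + (k\<^sup>2 / \<alpha>) b\<^sup>2\<close>, a perfect square divided by \<open>\<alpha>\<close>.
\<close>

lemma rotated_form_le_diagonal_form:
  fixes a b p q x y s t :: real
  assumes \<alpha>: "\<alpha> = s - (x * p\<^sup>2 + y * q\<^sup>2)" "\<alpha> > 0"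
    and t: "x * q\<^sup>2 + y * p\<^sup>2 + ((x - y) * p * q)\<^sup>2 / \<alpha> \<le> t"
  shows "x * (p * a + q * b)\<^sup>2 + y * (q * a - p * b)\<^sup>2 \<le> s * a\<^sup>2 + t * b\<^sup>2"
proof -
  define k where "k = (x - y) * p * q"
  have "(x * q\<^sup>2 + y * p\<^sup>2 + k\<^sup>2 / \<alpha>) * b\<^sup>2 \<le> t * b\<^sup>2"
    using t by (intro mult_right_mono) (auto simp: k_def)
  moreover have "s * a\<^sup>2 + (x * q\<^sup>2 + y * p\<^sup>2 + k\<^sup>2 / \<alpha>) * b\<^sup>2 -
      (x * (p * a + q * b)\<^sup>2 + y * (q * a - p * b)\<^sup>2) = (\<alpha> * a - k * b)\<^sup>2 / \<alpha>"
  proof -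
    have "s = \<alpha> + (x * p\<^sup>2 + y * q\<^sup>2)"
      using \<alpha> by simp
    then have "s * a\<^sup>2 + (x * q\<^sup>2 + y * p\<^sup>2) * b\<^sup>2 -
        (x * (p * a + q * b)\<^sup>2 + y * (q * a - p * b)\<^sup>2) = \<alpha> * a\<^sup>2 - 2 * k * a * b"
      by (simp add: k_def power2_eq_square algebra_simps)
    moreover have "(\<alpha> * a - k * b)\<^sup>2 / \<alpha> = \<alpha> * a\<^sup>2 - 2 * k * a * b + k\<^sup>2 / \<alpha> * b\<^sup>2"
      using \<alpha>(2) by (simp add: power2_eq_square field_simps)
    ultimately show ?thesis
      by (simp add: distrib_right)
  qed
  moreover have "(\<alpha> * a - k * b)\<^sup>2 / \<alpha> \<ge> 0"
    using \<alpha>(2) by simp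
  ultimately show ?thesis
    by linarith
qed

text \<open>
  The bound \<open>r\<close> lets the caller have \<open>t\<close> as large as desired, which is where the half-line enters: a
  sufficiently large lower right entry compensates any off-diagonal entry.
\<close>

lemma operator_monotone_two_by_two:
  fixes \<phi> :: "complex \<times> complex \<Rightarrow> 'v" and f :: "real \<Rightarrow> real"
  assumes f: "operator_monotone_on TYPE('v) {a<..} f" and inj: "inj \<phi>"
    and x: "x > a" and y: "y > a" and pq: "p\<^sup>2 + q\<^sup>2 = 1" and s: "x * p\<^sup>2 + y * q\<^sup>2 < s"
  shows "\<exists>t>r. \<forall>b c. f x * (p * b + q * c)\<^sup>2 + f y * (q * b - p * c)\<^sup>2 \<le> f s * b\<^sup>2 + f t * c\<^sup>2"
proof -
  let ?P = "plane_space \<phi>"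
  define \<alpha> where "\<alpha> = s - (x * p\<^sup>2 + y * q\<^sup>2)"
  define t where "t = max (max r a + 1) (x * q\<^sup>2 + y * p\<^sup>2 + ((x - y) * p * q)\<^sup>2 / \<alpha>)"
  have t: "t > a" "t > r" "x * q\<^sup>2 + y * p\<^sup>2 + ((x - y) * p * q)\<^sup>2 / \<alpha> \<le> t"
    by (auto simp: t_def)
  have "a = a * p\<^sup>2 + a * q\<^sup>2"
    using pq by (metis distrib_left mult.right_neutral)
  also have "\<dots> \<le> x * p\<^sup>2 + y * q\<^sup>2"
    using x y by (intro add_mono mult_right_mono) auto
  finally have "s > a"
    using s by linarith
  interpret P: complex_hilbert_space ?P
    using inj by (rule complex_hilbert_space_plane)
  let ?T = "plane_op \<phi> p q (complex_of_real x) (complex_of_real y)"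
    and ?D = "plane_op \<phi> 1 0 (complex_of_real s) (complex_of_real t)"
  have cont: "continuous_on {min u v..max u v} f" if "u > a" "v > a" for u v
    using f that unfolding operator_monotone_on_def by (auto elim!: continuous_on_subset)
  have "op_le ?P ?T ?D"
    unfolding op_le_def diff_op_def
  proof
    fix v assume "v \<in> carrier ?P"
    then obtain b c where v: "v = \<phi> (b, c)"
      using inj by (auto simp: plane_simps)
    have "x * (cmod (p * b + q * c))\<^sup>2 + y * (cmod (q * b - p * c))\<^sup>2 \<le> s * (cmod b)\<^sup>2 + t * (cmod c)\<^sup>2"
      using rotated_form_le_diagonal_form[OF \<alpha>_def _ t(3), of "Re b" "Re c"]
        rotated_form_le_diagonal_form[OF \<alpha>_def _ t(3), of "Im b" "Im c"] s
      by (simp add: \<alpha>_def cmod_power2 distrib_left)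
    moreover have "cinner ?P (?D v \<ominus>\<^bsub>?P\<^esub> ?T v) v = complex_of_real (s * (cmod b)\<^sup>2 + t * (cmod c)\<^sup>2 -
        (x * (cmod (p * b + q * c))\<^sup>2 + y * (cmod (q * b - p * c))\<^sup>2))"
    proof -
      have "cinner ?P (?D v \<ominus>\<^bsub>?P\<^esub> ?T v) v = cinner ?P (?D v) v - cinner ?P (?T v) v"
        using P.self_adjoint_closed[OF self_adjoint_plane_op[OF inj]] \<open>v \<in> carrier ?P\<close>
        by (intro P.cinner_diff_left) auto
      then show ?thesis
        unfolding v plane_op_form[OF inj] by simp
    qed
    ultimately show "cinner ?P (?D v \<ominus>\<^bsub>?P\<^esub> ?T v) v \<in> \<real>\<^sub>\<ge>\<^sub>0"
      by (simp only: diff_ge_0_iff_ge nonneg_Reals_of_real_iff)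
  qed
  moreover have "spectrum_op ?P ?T \<subseteq> complex_of_real ` {a<..}" "spectrum_op ?P ?D \<subseteq> complex_of_real ` {a<..}"
    using spectrum_plane_op[OF inj pq, of "complex_of_real x" "complex_of_real y"] x y
      spectrum_plane_op[OF inj, of 1 0 "complex_of_real s" "complex_of_real t"] t \<open>s > a\<close> by auto
  ultimately have le: "op_le ?P (fun_calc ?P f ?T) (fun_calc ?P f ?D)"
    using f P.complex_hilbert_space_axioms self_adjoint_plane_op[OF inj]
    unfolding operator_monotone_on_def by blast
  have "f x * (p * b + q * c)\<^sup>2 + f y * (q * b - p * c)\<^sup>2 \<le> f s * b\<^sup>2 + f t * c\<^sup>2" for b c
  proof -
    let ?v = "\<phi> (complex_of_real b, complex_of_real c)"
    let ?T' = "plane_op \<phi> p q (complex_of_real (f x)) (complex_of_real (f y))"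
      and ?D' = "plane_op \<phi> 1 0 (complex_of_real (f s)) (complex_of_real (f t))"
    have v: "?v \<in> carrier ?P"
      using inj by (simp add: plane_simps)
    have "cinner ?P (?D' ?v \<ominus>\<^bsub>?P\<^esub> ?T' ?v) ?v \<in> \<real>\<^sub>\<ge>\<^sub>0"
      using le[unfolded op_le_def diff_op_def, rule_format, OF v]
      unfolding fun_calc_plane_op[OF inj pq cont[OF x y]]
        fun_calc_plane_op[OF inj _ cont[OF \<open>s > a\<close> t(1)], of 1 0, simplified] .
    also have "cinner ?P (?D' ?v \<ominus>\<^bsub>?P\<^esub> ?T' ?v) ?v = cinner ?P (?D' ?v) ?v - cinner ?P (?T' ?v) ?v"
      using P.self_adjoint_closed[OF self_adjoint_plane_op[OF inj] v] v
      by (intro P.cinner_diff_left) auto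
    finally have "0 \<le> Re (cinner ?P (?D' ?v) ?v - cinner ?P (?T' ?v) ?v)"
      by (simp add: complex_nonneg_Reals_iff)
    moreover have "cmod (complex_of_real p * complex_of_real b + complex_of_real q * complex_of_real c) = \<bar>p * b + q * c\<bar>"
      "cmod (complex_of_real q * complex_of_real b - complex_of_real p * complex_of_real c) = \<bar>q * b - p * c\<bar>"
      by (metis norm_of_real of_real_add of_real_diff of_real_mult)+
    ultimately show ?thesis
      unfolding plane_op_form[OF inj] by simp
  qed
  then show ?thesis
    using t(2) by blast
qed

text \<open>
  The multiples of a nonzero vector are as many as the complex numbers, hence as many as pairs of them.
\<close>

lemma (in complex_hilbert_space) ex_inj_plane: "\<exists>\<phi> :: complex \<times> complex \<Rightarrow> 'v. inj \<phi>"
proof -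
  obtain x where x: "x \<in> carrier H" "hnorm H x > 0"
    by (rule ex_nonzero)
  have "inj (\<lambda>c. c \<odot>\<^bsub>H\<^esub> x)"
  proof (rule injI)
    fix c d assume "c \<odot>\<^bsub>H\<^esub> x = d \<odot>\<^bsub>H\<^esub> x"
    then have "c * cinner H x x = d * cinner H x x"
      using cinner_smult_left[OF x(1) x(1)] by metis
    then show "c = d"
      using x by (simp add: cinner_self)
  qed
  moreover obtain g :: "complex \<times> complex \<Rightarrow> complex" where "inj g"
  proof -
    have "\<exists>g. bij_betw g (UNIV \<times> UNIV :: (complex \<times> complex) set) (UNIV :: complex set)"
      unfolding card_of_ordIso by (intro card_of_Times_same_infinite infinite_UNIV_char_0)
    then show ?thesis
      using that by (auto simp: bij_betw_def)
  qed
  ultimately show ?thesis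
    using inj_compose[of "\<lambda>c. c \<odot>\<^bsub>H\<^esub> x" g] by blast
qed

lemma operator_monotone_mono:
  fixes \<phi> :: "complex \<times> complex \<Rightarrow> 'v" and f :: "real \<Rightarrow> real"
  assumes f: "operator_monotone_on TYPE('v) {a<..} f" and inj: "inj \<phi>"
    and xy: "a < x" "x \<le> y"
  shows "f x \<le> f y"
proof (cases "x = y")
  case False
  then obtain t where "\<And>b c. f x * (1 * b + 0 * c)\<^sup>2 + f x * (0 * b - 1 * c)\<^sup>2 \<le> f y * b\<^sup>2 + f t * c\<^sup>2"
    using operator_monotone_two_by_two[OF f inj xy(1) xy(1), of 1 0 y 0] xy by auto
  from this[of 1 0] show ?thesis
    by simp
qed simp

text \<open>
  The weights are \<open>u = p\<^sup>2\<close> and \<open>v = q\<^sup>2\<close>, and \<open>s\<close> decreases to \<open>u x + v y\<close>.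
\<close>

lemma operator_monotone_concave:
  fixes \<phi> :: "complex \<times> complex \<Rightarrow> 'v" and f :: "real \<Rightarrow> real"
  assumes f: "operator_monotone_on TYPE('v) {a<..} f" and inj: "inj \<phi>"
  shows "concave_on {a<..} f"
  unfolding concave_on_iff
proof (intro conjI ballI allI impI)
  show "convex {a<..}"
    by simp
  fix x y u v :: real
  assume x: "x \<in> {a<..}" and y: "y \<in> {a<..}" and uv: "0 \<le> u" "0 \<le> v" "u + v = 1"
  define c where "c = u * x + v * y"
  have "c \<in> {a<..}"
    unfolding c_def using convexD[OF _ x y uv] by simp
  then have "isCont f c"
    using f unfolding operator_monotone_on_def by (metis continuous_on_eq_continuous_at open_greaterThan)
  then have lim: "(f \<longlongrightarrow> f c) (at_right c)"
    by (simp add: isCont_def filterlim_at_split)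
  have "u * f x + v * f y \<le> f s" if "s > c" for s
  proof -
    have "(sqrt u)\<^sup>2 + (sqrt v)\<^sup>2 = 1" "x * (sqrt u)\<^sup>2 + y * (sqrt v)\<^sup>2 < s"
      using uv that by (simp_all add: c_def mult.commute)
    then obtain t where "\<And>b c. f x * (sqrt u * b + sqrt v * c)\<^sup>2 + f y * (sqrt v * b - sqrt u * c)\<^sup>2 \<le> f s * b\<^sup>2 + f t * c\<^sup>2"
      using operator_monotone_two_by_two[OF f inj, of x y "sqrt u" "sqrt v" s 0] x y by auto
    from this[of 1 0] show ?thesis
      using uv by (simp add: mult.commute)
  qed
  then have "\<forall>\<^sub>F s in at_right c. u * f x + v * f y \<le> f s"
    by (auto simp: eventually_at_filter)
  then show "u * f x + v * f y \<le> f (u *\<^sub>R x + v *\<^sub>R y)"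
    using tendsto_lowerbound[OF lim] by (simp add: c_def)
qed

text \<open>
  Concavity and monotonicity are not enough here, as \<open>t \<mapsto> min t c\<close> shows. Two by two matrices are: the eigenvector \<open>(q, -p)\<close> for the eigenvalue \<open>c\<close> has a nonzero component where the larger
  diagonal matrix has the entry \<open>x\<close>, and \<open>f(x)\<close> below the final value would make the form of the
  larger operator too small on it.
\<close>

lemma operator_monotone_eventually_constant:
  fixes \<phi> :: "complex \<times> complex \<Rightarrow> 'v" and f :: "real \<Rightarrow> real"
  assumes f: "operator_monotone_on TYPE('v) {a<..} f" and inj: "inj \<phi>"
    and c: "c > a" and const: "\<And>t. t \<ge> c \<Longrightarrow> f t = f c" and x: "x > a"
  shows "f x = f c"
proof (cases "x < c")
  case False
  then show ?thesis
    by (intro const) simp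
next
  case True
  define w where "w = (a + x) / 2"
  have w: "a < w" "w < x"
    using x by (auto simp: w_def)
  \<comment> \<open>The weight of the eigenvalue \<open>c\<close> in the upper left entry, small enough to keep this entry below \<open>x\<close>.\<close>
  define \<theta> where "\<theta> = (x - w) / 2 / (c - w)"
  have "\<theta> * (c - w) = (x - w) / 2"
    using w True nonzero_eq_divide_eq[of "c - w" \<theta> "(x - w) / 2"] by (simp add: \<theta>_def)
  then have less: "\<theta> * (c - w) < x - w"
    using w by simp
  have "0 < \<theta>"
    unfolding \<theta>_def using w True by (intro divide_pos_pos) auto
  moreover have "\<theta> < 1"
  proof (rule mult_right_less_imp_less)
    show "\<theta> * (c - w) < 1 * (c - w)"
      using less True by simp
  qed (use w True in simp)
  ultimately have \<theta>: "0 < \<theta>" "\<theta> < 1" "\<theta> * (c - w) < x - w"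
    using less by blast+
  have sq: "(sqrt (1 - \<theta>))\<^sup>2 + (sqrt \<theta>)\<^sup>2 = 1"
    using \<theta> by simp
  have "w * (sqrt (1 - \<theta>))\<^sup>2 + c * (sqrt \<theta>)\<^sup>2 < x"
    using \<theta> by (simp add: algebra_simps)
  then obtain t where "t > c" and le: "\<And>b d. f w * (sqrt (1 - \<theta>) * b + sqrt \<theta> * d)\<^sup>2 +
      f c * (sqrt \<theta> * b - sqrt (1 - \<theta>) * d)\<^sup>2 \<le> f x * b\<^sup>2 + f t * d\<^sup>2"
    using operator_monotone_two_by_two[OF f inj w(1) c sq, of x c] by blast
  have "sqrt \<theta> * sqrt \<theta> - sqrt (1 - \<theta>) * - sqrt (1 - \<theta>) = 1"
    using \<theta> by simp
  then have "f c \<le> f x * \<theta> + f t * (1 - \<theta>)"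
    using le[of "sqrt \<theta>" "- sqrt (1 - \<theta>)"] \<theta> by (simp add: mult.commute)
  then have "f c * \<theta> \<le> f x * \<theta>"
    using const[of t] \<open>t > c\<close> by (simp add: algebra_simps)
  then have "f c \<le> f x"
    using \<theta>(1) by simp
  then show ?thesis
    using operator_monotone_mono[OF f inj x, of c] True by simp
qed

text \<open>
  Both \<open>s + m\<close> and \<open>t\<close> lie between \<open>s\<close> and \<open>t + m\<close>, with weights interchanged; the two
  concavity inequalities add up to the claim.
\<close>

lemma concave_on_increment_antimono:
  fixes f :: "real \<Rightarrow> real"
  assumes f: "concave_on S f" and st: "s \<in> S" "t + m \<in> S" "s \<le> t" and m: "m > 0"
  shows "f (t + m) - f t \<le> f (s + m) - f s"
proof -
  define \<theta> where "\<theta> = m / (t + m - s)"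
  have \<theta>: "0 \<le> \<theta>" "\<theta> \<le> 1" and eq: "\<theta> * (t + m - s) = m"
    using st(3) m by (auto simp: \<theta>_def)
  have "(1 - \<theta>) * f s + \<theta> * f (t + m) \<le> f ((1 - \<theta>) * s + \<theta> * (t + m))"
    using f st \<theta> unfolding concave_on_iff by (simp add: Ball_def)
  moreover have "\<theta> * f s + (1 - \<theta>) * f (t + m) \<le> f (\<theta> * s + (1 - \<theta>) * (t + m))"
    using f st \<theta> unfolding concave_on_iff by (simp add: Ball_def)
  moreover have "(1 - \<theta>) * s + \<theta> * (t + m) = s + m" "\<theta> * s + (1 - \<theta>) * (t + m) = t"
    using eq by (simp_all add: algebra_simps)
  ultimately have "(1 - \<theta>) * f s + \<theta> * f (t + m) \<le> f (s + m)" "\<theta> * f s + (1 - \<theta>) * f (t + m) \<le> f t"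
    by simp_all
  then show ?thesis
    by (simp add: algebra_simps)
qed

text \<open>
  If one increment vanishes, concavity makes all later ones vanish, so \<open>f\<close> is constant from there on, and then
  everywhere.
\<close>

lemma operator_monotone_strict:
  fixes \<phi> :: "complex \<times> complex \<Rightarrow> 'v" and f :: "real \<Rightarrow> real"
  assumes f: "operator_monotone_on TYPE('v) {a<..} f" and inj: "inj \<phi>"
    and nc: "\<not> f constant_on {a<..}" and x: "a < x" and m: "m > 0"
  shows "f x < f (x + m)"
proof (rule ccontr)
  assume "\<not> f x < f (x + m)"
  then have eq: "f (x + m) = f x"
    using operator_monotone_mono[OF f inj x, of "x + m"] m by simp
  have const: "f t = f x" if "t \<ge> x" for t
  proof -
    have iterate: "f (x + real n * m) \<le> f x" for n
    proof (induction n)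
      case (Suc n)
      have "0 \<le> real n * m"
        using m by simp
      then have "a < x + real n * m + m"
        using x m by linarith
      with \<open>0 \<le> real n * m\<close> have "f (x + real n * m + m) - f (x + real n * m) \<le> f (x + m) - f x"
        using x m by (intro concave_on_increment_antimono[OF operator_monotone_concave[OF f inj]]) auto
      then show ?case
        using Suc.IH eq by (simp add: algebra_simps)
    qed simp
    obtain n :: nat where "t - x < real n * m"
      using ex_less_of_nat_mult[OF m] by blast
    then have "f t \<le> f (x + real n * m)"
      using x that by (intro operator_monotone_mono[OF f inj]) auto
    then show ?thesis
      using iterate[of n] operator_monotone_mono[OF f inj x that] by linarith
  qed
  have "f constant_on {a<..}"
    using operator_monotone_eventually_constant[OF f inj x const] unfolding constant_on_def by auto
  then show False
    using nc by blast
qed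

section \<open>Comparison of the images of two operators\<close>

theorem corollary3p5:
  fixes a m :: real and f :: "real \<Rightarrow> real"
    and H :: "'v hilbert" and A B :: "'v \<Rightarrow> 'v"
  assumes "operator_monotone_on TYPE('v) {a<..} f"
    and "\<not> f constant_on {a<..}"
    and "\<And>t. t > a \<Longrightarrow> f t < 0"
    and "complex_hilbert_space H"
    and "self_adjoint_op H A" and "self_adjoint_op H B"
    and "spectrum_op H A \<subseteq> complex_of_real ` {a<..}"
    and "spectrum_op H B \<subseteq> complex_of_real ` {a<..}"
    and "m > 0"
    and "op_le H (scalar_op H (complex_of_real m)) (diff_op H A B)"
  defines "\<sigma>A \<equiv> max_spectrum H A" and "\<sigma>B \<equiv> max_spectrum H B"
  shows "op_le H (scalar_op H (complex_of_real (f (\<sigma>B + m) - f \<sigma>B)))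
                 (diff_op H (fun_calc H f A) (fun_calc H f B)) \<and>
         f (\<sigma>B + m) - f \<sigma>B \<ge> f \<sigma>A - f (\<sigma>A - m) \<and>
         f \<sigma>A - f (\<sigma>A - m) > 0"
proof -
  interpret complex_hilbert_space H
    by fact
  note f = assms(1) and A = assms(5) and B = assms(6)
  obtain \<phi> :: "complex \<times> complex \<Rightarrow> 'v" where inj: "inj \<phi>"
    using ex_inj_plane by blast
  note concave = operator_monotone_concave[OF f inj]
  obtain lA where lA: "complex_of_real lA \<in> spectrum_op H A" "complex_of_real \<sigma>A \<in> spectrum_op H A"
      "\<And>t. complex_of_real t \<in> spectrum_op H A \<Longrightarrow> lA \<le> t \<and> t \<le> \<sigma>A"
    and formA: "\<And>x. x \<in> carrier H \<Longrightarrow> Re (cinner H (A x) x) \<le> \<sigma>A * (hnorm H x)\<^sup>2"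
    unfolding \<sigma>A_def using A by (rule spectrum_hull) blast
  obtain lB where lB: "complex_of_real lB \<in> spectrum_op H B" "complex_of_real \<sigma>B \<in> spectrum_op H B"
      "\<And>t. complex_of_real t \<in> spectrum_op H B \<Longrightarrow> lB \<le> t \<and> t \<le> \<sigma>B"
    unfolding \<sigma>B_def using B by (rule spectrum_hull) blast
  have gt: "lA > a" "lB > a" "\<sigma>B > a"
    using lA lB assms(7,8) by auto
  have specA: "real_spectrum A \<subseteq> {lA..\<sigma>A}" and specB: "real_spectrum B \<subseteq> {lB..\<sigma>B}"
    using lA(3) lB(3) by (auto simp: real_spectrum_def)
  have cont: "continuous_on {l..u} f" if "l > a" for l u
    using f that unfolding operator_monotone_on_def by (auto elim!: continuous_on_subset)
  note [simp] = self_adjoint_closed[OF A] self_adjoint_closed[OF B]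
  let ?C = "\<lambda>x. B x \<oplus>\<^bsub>H\<^esub> complex_of_real m \<odot>\<^bsub>H\<^esub> x"
  note C = self_adjoint_shift[OF B, of m]
  have AC: "cinner H (A x \<ominus>\<^bsub>H\<^esub> ?C x) x \<in> \<real>\<^sub>\<ge>\<^sub>0" if x: "x \<in> carrier H" for x
  proof -
    have "A x \<ominus>\<^bsub>H\<^esub> ?C x = (A x \<ominus>\<^bsub>H\<^esub> B x) \<ominus>\<^bsub>H\<^esub> complex_of_real m \<odot>\<^bsub>H\<^esub> x"
      using x by (intro vec_eqI) (simp_all add: cinner_simps)
    then show ?thesis
      using assms(10) x by (simp add: op_le_def diff_op_def scalar_op_def)
  qed
  \<comment> \<open>The form of \<open>B\<close> is at most \<open>\<sigma>A - m\<close>, so no larger number belongs to the spectrum of \<open>B\<close>.\<close>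
  have gap: "\<sigma>B \<le> \<sigma>A - m"
  proof (rule ccontr)
    assume "\<not> \<sigma>B \<le> \<sigma>A - m"
    moreover have "Re (cinner H (B x) x) \<le> (\<sigma>A - m) * (hnorm H x)\<^sup>2" if x: "x \<in> carrier H" for x
      using AC[OF x] formA[OF x] x
      by (simp add: complex_nonneg_Reals_iff cinner_simps hnorm_sq algebra_simps)
    ultimately show False
      using not_in_spectrum_above[OF B, of "\<sigma>A - m" \<sigma>B] lB(2) by simp
  qed
  have "spectrum_op H ?C \<subseteq> complex_of_real ` {a<..}"
  proof
    fix z assume "z \<in> spectrum_op H ?C"
    then have "z - complex_of_real m \<in> complex_of_real ` {a<..}"
      using spectrum_op_shift[OF B] assms(8) by blast
    then obtain t where "t > a" "z = complex_of_real (t + m)"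
      by (auto simp: algebra_simps)
    then show "z \<in> complex_of_real ` {a<..}"
      using \<open>m > 0\<close> by (intro image_eqI[of _ _ "t + m"]) auto
  qed
  moreover have "op_le H ?C A"
    using AC by (simp add: op_le_def diff_op_def)
  ultimately have mono: "op_le H (fun_calc H f ?C) (fun_calc H f A)"
    using f A C assms(4,7) unfolding operator_monotone_on_def by blast
  have "op_le H (scalar_op H (complex_of_real (f (\<sigma>B + m) - f \<sigma>B))) (diff_op H (fun_calc H f A) (fun_calc H f B))"
    unfolding op_le_def
  proof
    fix x assume x: "x \<in> carrier H"
    let ?g = "f (\<sigma>B + m) - f \<sigma>B"
    obtain p where "uniform_limit {lA..\<sigma>A} (\<lambda>n. poly (p n)) f sequentially"
      using cont[OF gt(1)] by (rule Weierstrass_polys)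
    then have p: "uniform_limit (real_spectrum A) (\<lambda>n. poly (p n)) f sequentially"
      using specA by (rule uniform_limit_on_subset)
    obtain r where r: "uniform_limit {lB..\<sigma>B + m} (\<lambda>n. poly (r n)) f sequentially"
      using cont[OF gt(2)] by (rule Weierstrass_polys)
    have rB: "uniform_limit (real_spectrum B) (\<lambda>n. poly (r n)) f sequentially"
      using r by (rule uniform_limit_on_subset) (use specB \<open>m > 0\<close> in force)
    have "real_spectrum ?C \<subseteq> {lB..\<sigma>B + m}"
    proof
      fix t assume "t \<in> real_spectrum ?C"
      then have "t - m \<in> real_spectrum B"
        using spectrum_op_shift[OF B] by (simp add: real_spectrum_def)
      then show "t \<in> {lB..\<sigma>B + m}"
        using specB \<open>m > 0\<close> by force
    qed
    with r have rC: "uniform_limit (real_spectrum ?C) (\<lambda>n. poly (r n)) f sequentially"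
      by (rule uniform_limit_on_subset)
    have cl: "fun_calc H f A x \<in> carrier H" "fun_calc H f B x \<in> carrier H" "fun_calc H f ?C x \<in> carrier H"
      using bounded_op_closed[OF bounded_op_fun_calc[OF A p] x] bounded_op_closed[OF bounded_op_fun_calc[OF B rB] x]
        bounded_op_closed[OF bounded_op_fun_calc[OF C rC] x] by blast+
    have "?g * (hnorm H x)\<^sup>2 \<le> Re (cinner H (fun_calc H f ?C x) x) - Re (cinner H (fun_calc H f B x) x)"
    proof (rule fun_calc_shift_diff_ge[OF B cont[OF gt(2)] _ specB _ x])
      fix t assume "t \<in> real_spectrum B"
      then have t: "lB \<le> t" "t \<le> \<sigma>B"
        using specB by auto
      then show "?g \<le> f (t + m) - f t"
        using gt \<open>m > 0\<close> by (intro concave_on_increment_antimono[OF concave]) auto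
    qed (use \<open>m > 0\<close> in simp)
    moreover have "Re (cinner H (fun_calc H f ?C x) x) \<le> Re (cinner H (fun_calc H f A x) x)"
    proof -
      have "cinner H (fun_calc H f A x \<ominus>\<^bsub>H\<^esub> fun_calc H f ?C x) x \<in> \<real>\<^sub>\<ge>\<^sub>0"
        using mono x by (simp add: op_le_def diff_op_def)
      then show ?thesis
        using cl x by (simp add: complex_nonneg_Reals_iff cinner_diff_left)
    qed
    ultimately have "0 \<le> Re (cinner H (fun_calc H f A x) x) - Re (cinner H (fun_calc H f B x) x) - ?g * (hnorm H x)\<^sup>2"
      by linarith
    moreover have "cinner H (diff_op H (diff_op H (fun_calc H f A) (fun_calc H f B)) (scalar_op H (complex_of_real ?g)) x) x =
        cinner H (fun_calc H f A x) x - cinner H (fun_calc H f B x) x - complex_of_real (?g * (hnorm H x)\<^sup>2)"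
      using cl x by (simp add: diff_op_def scalar_op_def cinner_simps cinner_self)
    ultimately show "cinner H (diff_op H (diff_op H (fun_calc H f A) (fun_calc H f B)) (scalar_op H (complex_of_real ?g)) x) x \<in> \<real>\<^sub>\<ge>\<^sub>0"
      using Im_fun_calc_form[OF A p x] Im_fun_calc_form[OF B rB x]
      by (simp only: complex_nonneg_Reals_iff minus_complex.sel Re_complex_of_real Im_complex_of_real) simp
  qed
  moreover have "f \<sigma>A - f (\<sigma>A - m) \<le> f (\<sigma>B + m) - f \<sigma>B"
    using concave_on_increment_antimono[OF concave, of \<sigma>B "\<sigma>A - m" m] gap gt \<open>m > 0\<close> by simp
  moreover have "f (\<sigma>A - m) < f \<sigma>A"
    using operator_monotone_strict[OF f inj assms(2), of "\<sigma>A - m" m] gap gt \<open>m > 0\<close> by simp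
  ultimately show ?thesis
    by simp
qed

end
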